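(* Let $Q$ be an acyclic quiver of type $\tilde A_{p,q}$ ($p,q\ge 1$), $\tilde D_N$ ($N\ge 4$), $\tilde E_6$, $\tilde E_7$ or $\tilde E_8$, and let $(X^k_n)$, with $k$ a vertex of $Q$ and $n\in\mathbb Z$, be its frieze sequence. Let $b$ be given by $$b=\begin{cases}\operatorname{lcm}(p,q) & \text{for } \tilde A_{p,q},\\ N-2 & \text{for } \tilde D_N,\ N \text{ even},\\ 2N-4 & \text{for } \tilde D_N,\ N\text{ odd},\\ 6 & \text{for } \tilde E_6,\\ 12 & \text{for }\tilde E_7,\\ 30 & \text{for } \tilde E_8.\end{cases}$$ Then there is an element $\mathcal K$ of the field of rational functions in the initial variables $X^1_0,X^2_0,\dots$, invariant under the shift $\varphi^*$, such that for every extending vertex $k$ and all $n\in\mathbb Z$ $$X^k_{n+2b}-\mathcal K X^k_{n+b}+X^k_n=0 .$$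
   Context: Let $Q$ be an acyclic quiver with vertices $1,\dots,N+1$. Its frieze sequence $(X^k_n)$ consists of elements of the field $F=\mathbb C(X^1_0,\dots,X^{N+1}_0)$, where the $X^k_0$ are independent initial variables, determined for all $n\in\mathbb Z$ by $$X^k_{n+1}X^k_n=1+\Big(\prod_{i\to k}X^i_n\Big)\Big(\prod_{i\leftarrow k}X^i_{n+1}\Big),\qquad k=1,\dots,N+1,$$ where the products run over the arrows of $Q$ into $k$ and out of $k$ respectively (counted with multiplicity). Since $Q$ is acyclic this determines all $X^k_{n+1}$ recursively from the $X^k_n$, and conversely. The shift $\varphi^*$ is the field automorphism of $F$ with $\varphi^*(X^k_n)=X^k_{n+1}$ for all $k,n$; an element is invariant if it is fixed by $\varphi^*$. Underlying graphs. $\tilde A_{p,q}$: a cycle with $N+1=p+q$ vertices with $p$ arrows oriented clockwise and $q$ anticlockwise (for $p=q=1$, two vertices joined by two parallel arrows). $\tilde D_N$: vertices $1,\dots,N+1$ and edges $\{1,3\},\{2,3\}$, $\{i,i+1\}$ for $3\le i\le N-2$, $\{N-1,N\},\{N-1,N+1\}$. $\tilde E_6$: a star with one central vertex and three arms having two further vertices each. $\tilde E_7$: a star with arms of $3,3,1$ further vertices. $\tilde E_8$: a star with arms of $5,2,1$ further vertices. Extending vertices: all vertices for $\tilde A_{p,q}$; the four leaves $1,2,N,N+1$ for $\tilde D_N$; the three leaves for $\tilde E_6$; the two leaves at the ends of the arms with three vertices for $\tilde E_7$; the leaf at the end of the arm with five vertices for $\tilde E_8$. *)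

theory Defs
  imports
    Complex_Main
    "HOL-Library.Poly_Mapping"
    "HOL-Computational_Algebra.Polynomial_Factorial"
    "Graph_Theory.Digraph"
begin

section \<open>The field of rational functions\<close>

text \<open>
  The polynomial ring over the complex numbers in the indeterminates indexed by \<open>'v\<close> (finitely
  supported maps from exponent vectors to coefficients), and its field of fractions.
  The vertex type is finite in the theorem, so that this is the field of rational functions in
  exactly the \<open>N + 1\<close> initial variables. A linear order on \<open>'v\<close> is needed only because the
  library proves with it that the polynomial ring is an integral domain; it plays no other role.
\<close>

type_synonym 'v cpoly = "('v \<Rightarrow>\<^sub>0 nat) \<Rightarrow>\<^sub>0 complex"
type_synonym 'v ratfun = "'v cpoly fract"

definition rf_const :: "complex \<Rightarrow> ('v::linorder) ratfun" where
  "rf_const c = to_fract (Poly_Mapping.single 0 c)"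

definition rf_var :: "'v \<Rightarrow> ('v::linorder) ratfun" where
  "rf_var k = to_fract (Poly_Mapping.single (Poly_Mapping.single k 1) 1)"


section \<open>Frieze sequences\<close>

text \<open>
  A quiver is a directed multigraph; an arc \<open>a\<close> is an arrow from \<open>tail Q a\<close> to \<open>head Q a\<close>.
  Indexing the products by arcs counts multiplicities.
\<close>

definition acyclic_quiver :: "('v, 'e) pre_digraph \<Rightarrow> bool" where
  "acyclic_quiver Q \<longleftrightarrow> fin_digraph Q \<and> acyclic (arcs_ends Q)"

definition frieze_sequence ::
    "('v::linorder, 'e) pre_digraph \<Rightarrow> ('v \<Rightarrow> int \<Rightarrow> 'v ratfun) \<Rightarrow> bool" where
  "frieze_sequence Q X \<longleftrightarrow>
     (\<forall>k\<in>verts Q. X k 0 = rf_var k) \<and>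
     (\<forall>k\<in>verts Q. \<forall>n.
        X k (n + 1) * X k n =
          1 + (\<Prod>a\<in>in_arcs Q k. X (tail Q a) n) * (\<Prod>a\<in>out_arcs Q k. X (head Q a) (n + 1)))"

text \<open>
  The shift is an automorphism of the field over the complex numbers: constants are fixed.
\<close>

definition is_shift ::
    "('v::linorder, 'e) pre_digraph \<Rightarrow> ('v \<Rightarrow> int \<Rightarrow> 'v ratfun) \<Rightarrow> ('v ratfun \<Rightarrow> 'v ratfun) \<Rightarrow> bool"
  where
  "is_shift Q X \<phi> \<longleftrightarrow>
     bij \<phi> \<and>
     (\<forall>f g. \<phi> (f + g) = \<phi> f + \<phi> g) \<and>
     (\<forall>f g. \<phi> (f * g) = \<phi> f * \<phi> g) \<and>
     (\<forall>c. \<phi> (rf_const c) = rf_const c) \<and>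
     (\<forall>k\<in>verts Q. \<forall>n. \<phi> (X k n) = X k (n + 1))"


section \<open>Quivers of affine type\<close>

datatype affine_type =
    A_tilde nat nat
  | D_tilde nat
  | E6_tilde
  | E7_tilde
  | E8_tilde

fun admissible :: "affine_type \<Rightarrow> bool" where
  "admissible (A_tilde p q) \<longleftrightarrow> p \<ge> 1 \<and> q \<ge> 1"
| "admissible (D_tilde N) \<longleftrightarrow> N \<ge> 4"
| "admissible E6_tilde \<longleftrightarrow> True"
| "admissible E7_tilde \<longleftrightarrow> True"
| "admissible E8_tilde \<longleftrightarrow> True"

text \<open>
  The vertices of each diagram are labelled \<open>1, \<dots>, N + 1\<close>. In the types E the label 1 is the
  central vertex, and the labels increase along each arm, going outwards.
\<close>

fun num_vertices :: "affine_type \<Rightarrow> nat" where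
  "num_vertices (A_tilde p q) = p + q"
| "num_vertices (D_tilde N) = N + 1"
| "num_vertices E6_tilde = 7"
| "num_vertices E7_tilde = 8"
| "num_vertices E8_tilde = 9"

definition D_tilde_edges :: "nat \<Rightarrow> nat set set" where
  "D_tilde_edges N =
     {{1, 3}, {2, 3}} \<union> {{i, i + 1} |i. 3 \<le> i \<and> i \<le> N - 2} \<union> {{N - 1, N}, {N - 1, N + 1}}"

definition E6_tilde_edges :: "nat set set" where
  "E6_tilde_edges = {{1, 2}, {2, 3}, {1, 4}, {4, 5}, {1, 6}, {6, 7}}"

definition E7_tilde_edges :: "nat set set" where
  "E7_tilde_edges = {{1, 2}, {2, 3}, {3, 4}, {1, 5}, {5, 6}, {6, 7}, {1, 8}}"

definition E8_tilde_edges :: "nat set set" where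
  "E8_tilde_edges = {{1, 2}, {2, 3}, {3, 4}, {4, 5}, {5, 6}, {1, 7}, {7, 8}, {1, 9}}"

text \<open>
  The underlying graph of \<open>Q\<close> is the simple graph with edge set \<open>E\<close>, transported along the
  labelling \<open>l\<close>: injectivity excludes multiple arrows, while each orientation is allowed.
\<close>

definition underlying_simple_graph ::
    "nat set set \<Rightarrow> (nat \<Rightarrow> 'v) \<Rightarrow> ('v, 'e) pre_digraph \<Rightarrow> bool" where
  "underlying_simple_graph E l Q \<longleftrightarrow>
     bij_betw (\<lambda>a. {tail Q a, head Q a}) (arcs Q) ((\<lambda>e. l ` e) ` E)"

text \<open>
  A cycle with \<open>p + q\<close> edges, the edge \<open>e i\<close> joining the vertices labelled \<open>i\<close> and \<open>i + 1\<close>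
  (cyclically), with \<open>p\<close> arrows in the direction of increasing labels and \<open>q\<close> in the other.
  For \<open>p = q = 1\<close> this gives two parallel arrows.
\<close>

definition oriented_cycle ::
    "nat \<Rightarrow> nat \<Rightarrow> (nat \<Rightarrow> 'v) \<Rightarrow> ('v, 'e) pre_digraph \<Rightarrow> bool" where
  "oriented_cycle p q l Q \<longleftrightarrow>
     (\<exists>e C D. bij_betw e {1..p + q} (arcs Q) \<and>
        C \<union> D = {1..p + q} \<and> C \<inter> D = {} \<and> card C = p \<and> card D = q \<and>
        (\<forall>i\<in>C. tail Q (e i) = l i \<and> head Q (e i) = l (i mod (p + q) + 1)) \<and>
        (\<forall>i\<in>D. tail Q (e i) = l (i mod (p + q) + 1) \<and> head Q (e i) = l i))"

fun has_diagram :: "affine_type \<Rightarrow> (nat \<Rightarrow> 'v) \<Rightarrow> ('v, 'e) pre_digraph \<Rightarrow> bool" where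
  "has_diagram (A_tilde p q) l Q \<longleftrightarrow> oriented_cycle p q l Q"
| "has_diagram (D_tilde N) l Q \<longleftrightarrow> underlying_simple_graph (D_tilde_edges N) l Q"
| "has_diagram E6_tilde l Q \<longleftrightarrow> underlying_simple_graph E6_tilde_edges l Q"
| "has_diagram E7_tilde l Q \<longleftrightarrow> underlying_simple_graph E7_tilde_edges l Q"
| "has_diagram E8_tilde l Q \<longleftrightarrow> underlying_simple_graph E8_tilde_edges l Q"

text \<open>
  \<open>Q\<close> is of type \<open>T\<close>, the labelling \<open>l\<close> identifying its vertices with those of the diagram.
\<close>

definition quiver_of_type ::
    "affine_type \<Rightarrow> (nat \<Rightarrow> 'v) \<Rightarrow> ('v, 'e) pre_digraph \<Rightarrow> bool" where
  "quiver_of_type T l Q \<longleftrightarrow>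
     admissible T \<and> bij_betw l {1..num_vertices T} (verts Q) \<and> has_diagram T l Q"

fun extending_labels :: "affine_type \<Rightarrow> nat set" where
  "extending_labels (A_tilde p q) = {1..p + q}"
| "extending_labels (D_tilde N) = {1, 2, N, N + 1}"
| "extending_labels E6_tilde = {3, 5, 7}"
| "extending_labels E7_tilde = {4, 7}"
| "extending_labels E8_tilde = {6}"

fun period :: "affine_type \<Rightarrow> nat" where
  "period (A_tilde p q) = lcm p q"
| "period (D_tilde N) = (if even N then N - 2 else 2 * N - 4)"
| "period E6_tilde = 6"
| "period E7_tilde = 12"
| "period E8_tilde = 30"

end

theory Submission
  imports Defs
begin

text \<open>
  The orientation can be absorbed into the time parameter: after replacing \<open>X k n\<close> by
  \<open>X k (n + h k)\<close> for suitable \<open>h\<close>, every orientation of a tree gives the same recurrence (and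
  for a cycle only \<open>p\<close> and \<open>q\<close> matter). An arm of the diagram is then filled with the continuants of
  the sequence at its leaf. Comparing the arms, the sequences \<open>u\<close> formed from the extending
  vertices (with step 2, 3, 6 in types E6, E7, E8, and passing cyclically from leaf to leaf)
  all satisfy one Hill equation \<open>u (i + 1) + u (i - 1) = J i * u i\<close>, and comparing the
  expressions for \<open>J\<close> at different leaves shows that \<open>J\<close> is periodic. The trace of the monodromy
  matrix of this equation is the required \<open>K\<close>, and \<open>u (i + 2 * r) - K * u (i + r) + u i = 0\<close> is the
  theorem of Cayley and Hamilton.
\<close>

section \<open>Hill's equation with a periodic coefficient\<close>

text \<open>No monodromy matrix is formed. Since \<open>K\<close> has to be the same for all
  extending vertices and all times, it is eliminated: every type ends in a cross-multiplied
  \<open>trace\<close> relation between two leaves at two independent times, and \<open>K\<close> is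
  recovered as a quotient at one chosen leaf. These relations are obtained by cancelling frieze
  entries, so everything depends on their being nonzero, which the automorphism provides.

  Each \<open>b\<close> is the time step between consecutive terms of \<open>u\<close>, multiplied
  by a number of steps after which both \<open>J\<close> and the leaf recur: 2 * 3, 3 * 4 and 6 * 5
  in types E. In type D the step is 1 and \<open>J\<close> has period N - 2, but the two leaves of a
  pair alternate, so an odd N - 2 is doubled. In type A the sequence runs round the cycle at a fixed
  time: \<open>J\<close> has period q, one round counts as time p, and k rounds are a multiple of
  the period q exactly if q divides p * k, whence lcm(p, q).\<close>

lemma hill_core:
  fixes u v j :: "int \<Rightarrow> 'a::field"
  assumes per: "\<And>i. j (i + r) = j i"
    and u: "\<And>i. u (i + 1) + u (i - 1) = j i * u i"
    and v: "\<And>i. v (i + 1) + v (i - 1) = j i * v i"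
    and u0: "\<And>i. u i \<noteq> 0" and v0: "\<And>i. v i \<noteq> 0"
  shows "(u (i + 2 * r) + u i) * v (k + r) = (v (k + 2 * r) + v k) * u (i + r)"
proof -
  \<comment> \<open>The discrete Wronskian (Casoratian). Its constancy along two solutions replaces
    the statement that the monodromy has determinant 1.\<close>
  define W where "W f g i = f i * g (i + 1) - f (i + 1) * g i" for f g :: "int \<Rightarrow> 'a" and i
  define sol where "sol f \<longleftrightarrow> (\<forall>i. f (i + 1) + f (i - 1) = j i * f i)" for f
  have const: "f i = f 0" if "\<And>i. f (i + 1) = f i" for f :: "int \<Rightarrow> 'a" and i
  proof (induction i rule: int_induct[where k = 0])
    case (step2 i)
    then show ?case using that[of "i - 1"] by simp
  qed (use that in auto)
  have W_const: "W f g i = W f g 0" if "sol f" "sol g" for f g i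
  proof (rule const)
    fix i
    have "f (i + 2) = j (i + 1) * f (i + 1) - f i" "g (i + 2) = j (i + 1) * g (i + 1) - g i"
      using that[unfolded sol_def, rule_format, of "i + 1"] by (simp_all add: algebra_simps)
    then have "f (i + 1) * g (i + 2) - f (i + 2) * g (i + 1) = f i * g (i + 1) - f (i + 1) * g i"
      by algebra
    then show "W f g (i + 1) = W f g i"
      by (simp add: W_def add.assoc)
  qed
  have shift: "sol (\<lambda>i. f (i + r))" if "sol f" for f
    unfolding sol_def
  proof
    fix i
    show "f (i + 1 + r) + f (i - 1 + r) = j i * f (i + r)"
      using that[unfolded sol_def, rule_format, of "i + r"] per[of i] by (simp add: algebra_simps)
  qed
  have proportional: "\<exists>c. \<forall>i. f i = c * g i"
    if "\<And>i. g i \<noteq> 0" "\<And>i. W f g i = 0" for f g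
  proof -
    have "f i / g i = f 0 / g 0" for i
    proof (rule const[of "\<lambda>i. f i / g i"])
      fix i
      show "f (i + 1) / g (i + 1) = f i / g i"
        using that(2)[of i] that(1)[of i] that(1)[of "i + 1"] unfolding W_def by (simp add: field_simps)
    qed
    then have "f i = (f 0 / g 0) * g i" for i
      using that(1)[of i] by (metis nonzero_divide_eq_eq)
    then show ?thesis by blast
  qed
  have trace: "\<exists>K. \<forall>i. f (i + 2 * r) + f i = K * f (i + r)" if f: "sol f" "\<And>i. f i \<noteq> 0" for f
  proof (rule proportional)
    fix i
    \<comment> \<open>The pairing of \<open>f\<close> with its translate does not change under
      translation by \<open>r\<close>; by antisymmetry the two terms of
      \<open>f (i + 2 * r) + f i\<close> then cancel in the pairing with
      \<open>f (i + r)\<close>.\<close>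
    have "W f (\<lambda>i. f (i + r)) (i + r) = W f (\<lambda>i. f (i + r)) i"
      using W_const[OF f(1) shift[OF f(1)], of "i + r"] W_const[OF f(1) shift[OF f(1)], of i] by simp
    then show "W (\<lambda>i. f (i + 2 * r) + f i) (\<lambda>i. f (i + r)) i = 0"
      unfolding W_def by (simp add: algebra_simps)
  qed (use f in auto)
  have su: "sol u" and sv: "sol v" using u v by (auto simp: sol_def)
  obtain Ku where Ku: "\<And>i. u (i + 2 * r) + u i = Ku * u (i + r)" using trace[OF su u0] by blast
  obtain Kv where Kv: "\<And>i. v (i + 2 * r) + v i = Kv * v (i + r)" using trace[OF sv v0] by blast
  have "Ku = Kv"
  \<comment> \<open>Proportional solutions obviously share the factor. Otherwise the pairing of
    \<open>u\<close> and \<open>v\<close> is a nonzero constant, by which one may divide.\<close>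
  proof (cases "\<forall>i. W v u i = 0")
    case True
    then obtain c where c: "\<And>i. v i = c * u i" using proportional[of u v] u0 by blast
    have "c \<noteq> 0" using c[of 0] v0[of 0] by auto
    have "c * (u (2 * r) + u 0) = Kv * (c * u r)" using Kv[of 0] c by (simp add: algebra_simps)
    then have "c * (Ku * u r) = Kv * (c * u r)" using Ku[of 0] by simp
    then show ?thesis using \<open>c \<noteq> 0\<close> u0[of r] by simp
  next
    case False
    let ?su = "\<lambda>i. u (i + r)" and ?sv = "\<lambda>i. v (i + r)"
    have nz: "W ?su ?sv 0 \<noteq> 0"
    proof
      assume "W ?su ?sv 0 = 0"
      then have "W u v r = 0" by (simp add: W_def add.commute)
      then have "W u v i = 0" for i using W_const[OF su sv, of i] W_const[OF su sv, of r] by simp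
      then have "W v u i = 0" for i
        unfolding W_def by (metis mult.commute right_minus_eq)
      then show False using False by blast
    qed
    have eqs: "W u ?sv r = W u ?sv 0" "W ?su v r = W ?su v 0"
      using W_const[OF su shift[OF sv], of r] W_const[OF shift[OF su] sv, of r] by simp_all
    have Ku': "u (2 * r) + u 0 = Ku * u r" "u (1 + 2 * r) + u 1 = Ku * u (1 + r)"
      and Kv': "v (2 * r) + v 0 = Kv * v r" "v (1 + 2 * r) + v 1 = Kv * v (1 + r)"
      using Ku[of 0] Ku[of 1] Kv[of 0] Kv[of 1] by simp_all
    \<comment> \<open>Write M for translation by \<open>r\<close>; it preserves the pairing W. Then
      \<open>Ku\<close> times W(Mu, Mv) is W(u + MMu, Mv) = W(u, Mv) + W(Mu, v), and
      \<open>Kv\<close> times W(Mu, Mv) gives the same sum.\<close>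
    have "Ku * W ?su ?sv 0 = (Ku * u r) * v (1 + r) - (Ku * u (1 + r)) * v r"
      by (simp add: W_def algebra_simps)
    also have "\<dots> = W u ?sv 0 + W ?su v r"
      unfolding Ku'[symmetric] by (simp add: W_def algebra_simps)
    also have "\<dots> = W ?su v 0 + W u ?sv r" using eqs by simp
    also have "\<dots> = u r * (Kv * v (1 + r)) - u (1 + r) * (Kv * v r)"
      unfolding Kv'[symmetric] by (simp add: W_def algebra_simps)
    also have "\<dots> = Kv * W ?su ?sv 0"
      by (simp add: W_def algebra_simps)
    finally show ?thesis using nz by simp
  qed
  then show ?thesis by (simp only: Ku Kv mult.assoc mult.commute[of "u (i + r)"])
qed

text \<open>Different vertices meet the same coefficient with different offsets \<open>s\<close> and
  \<open>t\<close>; reindexing brings both sequences to a common origin. Values at 0 suffice, as the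
  applications build the time into \<open>u\<close> and \<open>v\<close>.\<close>

lemma hill:
  fixes u v j :: "int \<Rightarrow> 'a::field"
  assumes per: "\<And>i. j (i + r) = j i"
    and u: "\<And>i. u (i + 1) + u (i - 1) = j (i + s) * u i"
    and v: "\<And>i. v (i + 1) + v (i - 1) = j (i + t) * v i"
    and nz: "\<And>i. u i \<noteq> 0" "\<And>i. v i \<noteq> 0"
  shows "(u (2 * r) + u 0) * v r = (v (2 * r) + v 0) * u r"
proof -
  have "(u (s - s + 2 * r) + u (s - s)) * v (t - t + r) = (v (t - t + 2 * r) + v (t - t)) * u (s - s + r)"
    using hill_core[of j r "\<lambda>i. u (i - s)" "\<lambda>i. v (i - t)" s t] per nz
      u[of "_ - s"] v[of "_ - t"] by (simp add: algebra_simps)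
  then show ?thesis by simp
qed

lemma periodic_mult:
  fixes f :: "int \<Rightarrow> 'a"
  assumes "\<And>n. f (n + r) = f n"
  shows "f (n + r * k) = f n"
proof (induction k rule: int_induct[where k = 0])
  case (step1 k)
  then show ?case using assms[of "n + r * k"] by (simp add: algebra_simps)
next
  case (step2 k)
  then show ?case using assms[of "n + r * (k - 1)"] by (simp add: algebra_simps)
qed simp

section \<open>Continuants\<close>

text \<open>The determinant of the tridiagonal matrix of size \<open>k\<close> with diagonal
  \<open>f n\<close>, \<open>f (n + 1)\<close>, ... and ones beside the diagonal, expanded along its
  last row.\<close>

fun cont :: "(int \<Rightarrow> 'a::idom) \<Rightarrow> nat \<Rightarrow> int \<Rightarrow> 'a" where
  "cont f 0 n = 1"
| "cont f (Suc 0) n = f n"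
| "cont f (Suc (Suc k)) n = f (n + int k + 1) * cont f (Suc k) n - cont f k n"

text \<open>Euler's identity for two windows that overlap in \<open>k\<close> entries: on the right
  stand union times overlap, and the pieces left of \<open>s\<close> and \<open>j\<close> entries
  after deleting one entry on either side of the overlap. As functions of the right end, all terms
  obey one three-term recurrence. The case \<open>s = j = 0\<close> is the diamond rule of frieze
  patterns.\<close>

lemma cont_euler:
  "cont f (k + Suc s) n * cont f (k + Suc j) (n + int (Suc s))
    = cont f (k + Suc s + Suc j) n * cont f k (n + int (Suc s))
      + cont f s n * cont f j (n + int (k + Suc s) + 1)"
proof -
  define P where "P i = cont f (Suc (i + s)) n" for i
  define Q where "Q i = cont f i (n + int (Suc s))" for i
  define t where "t i = f (n + int i + int s + 2)" for i
  have P: "P (Suc (Suc i)) = t i * P (Suc i) - P i"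
    and Q: "Q (Suc (Suc i)) = t i * Q (Suc i) - Q i" for i
    by (simp_all add: P_def Q_def t_def algebra_simps)
  \<comment> \<open>The constant Wronskian of the two solutions \<open>P\<close> and
    \<open>Q\<close>.\<close>
  have one: "P k * Q (Suc k) = P (Suc k) * Q k + cont f s n" for k
  proof (induction k)
    case 0
    then show ?case by (simp add: P_def Q_def algebra_simps)
  next
    case (Suc k)
    then show ?case using P[of k] Q[of k] by algebra
  qed
  have "P k * Q (Suc (k + j)) = P (Suc (k + j)) * Q k + cont f s n * cont f j (n + int (k + Suc s) + 1)"
  proof (induction j rule: induct_nat_012)
    case 0
    then show ?case using one[of k] by simp
  next
    case 1
    have "cont f (Suc 0) (n + int (k + Suc s) + 1) = t k" by (simp add: t_def algebra_simps)
    moreover have "P k * Q (Suc (Suc k)) - P (Suc (Suc k)) * Q k = t k * (P k * Q (Suc k) - P (Suc k) * Q k)"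
      unfolding P Q by (simp add: algebra_simps)
    ultimately show ?case using one[of k] by (simp add: algebra_simps)
  next
    case (ge2 j)
    have "cont f (Suc (Suc j)) (n + int (k + Suc s) + 1)
        = t (Suc (k + j)) * cont f (Suc j) (n + int (k + Suc s) + 1) - cont f j (n + int (k + Suc s) + 1)"
      by (simp add: t_def algebra_simps)
    then show ?case using ge2 P[of "Suc (k + j)"] Q[of "Suc (k + j)"] by simp algebra
  qed
  then show ?thesis by (simp add: P_def Q_def add.commute add.left_commute)
qed

lemma cont_expand:
  "cont f 2 n = f n * f (n + 1) - 1"
  "cont f 3 n = f (n + 2) * cont f 2 n - f n"
  "cont f 4 n = f (n + 3) * cont f 3 n - cont f 2 n"
  "cont f 5 n = f (n + 4) * cont f 4 n - cont f 3 n"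
  "cont f 6 n = f (n + 5) * cont f 5 n - cont f 4 n"
  "cont f 7 n = f (n + 6) * cont f 6 n - cont f 5 n"
  "cont f 8 n = f (n + 7) * cont f 7 n - cont f 6 n"
  using cont.simps(3)[of f 0 n] cont.simps(3)[of f 1 n] cont.simps(3)[of f 2 n] cont.simps(3)[of f 3 n]
    cont.simps(3)[of f 4 n] cont.simps(3)[of f 5 n] cont.simps(3)[of f 6 n]
  by (simp_all add: add.assoc mult.commute numeral_2_eq_2[symmetric] del: cont.simps(3))

lemma cont_shift: "cont (\<lambda>i. f (i + m)) k n = cont f k (n + m)"
  by (induction f k n rule: cont.induct) (simp_all add: algebra_simps)

text \<open>The determinant expanded along its first row. It gives the recursion towards earlier
  times and makes continuants palindromic, as needed for reversal of time.\<close>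

lemma cont_left: "cont f (Suc (Suc k)) n = f n * cont f (Suc k) (n + 1) - cont f k (n + 2)"
proof (induction k rule: less_induct)
  case (less k)
  consider "k = 0" | "k = 1" | l where "k = Suc (Suc l)"
    by (metis One_nat_def not0_implies_Suc)
  then show ?case
  proof cases
    case 3
    have ih: "cont f (Suc (Suc l)) n = f n * cont f (Suc l) (n + 1) - cont f l (n + 2)"
      "cont f (Suc (Suc (Suc l))) n = f n * cont f (Suc (Suc l)) (n + 1) - cont f (Suc l) (n + 2)"
      using less[of l] less[of "Suc l"] 3 by auto
    define t where "t = f (n + int l + 3)"
    have "cont f (Suc (Suc (Suc (Suc l)))) n = t * cont f (Suc (Suc (Suc l))) n - cont f (Suc (Suc l)) n"
      "cont f (Suc (Suc (Suc l))) (n + 1) = t * cont f (Suc (Suc l)) (n + 1) - cont f (Suc l) (n + 1)"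
      "cont f (Suc (Suc l)) (n + 2) = t * cont f (Suc l) (n + 2) - cont f l (n + 2)"
      by (simp_all add: t_def algebra_simps)
    then show ?thesis unfolding 3 by (simp only: ih) (simp only: algebra_simps)
  qed (simp_all add: algebra_simps)
qed

lemma cont_mirror: "cont (\<lambda>i. f (s - i)) k n = cont f k (s - n - int k + 1)"
proof (induction "\<lambda>i. f (s - i)" k n rule: cont.induct)
  case (3 k n)
  then show ?case
    using cont_left[of f k "s - n - int (Suc (Suc k)) + 1"] by (simp add: algebra_simps)
qed simp_all

text \<open>A mesh relation along an arm has the form of the diamond rule, so dividing by the
  nonzero entry \<open>A (n + 1)\<close> identifies the next factor with the next continuant. At the
  centre, \<open>C\<close> is a product of entries of the other arms.\<close>

lemma cont_step:
  fixes f :: "int \<Rightarrow> 'a::field"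
  assumes "cont f k = A" "cont f k1 = B"
    and "\<And>n. B (n + 1) * B n = 1 + A (n + 1) * C n" and "\<And>n. A n \<noteq> 0"
    and k: "k1 = Suc k" "k2 = Suc k1"
  shows "cont f k2 = C"
proof
  fix n
  have "cont f (Suc k) n * cont f (Suc k) (n + 1) = cont f (Suc (Suc k)) n * cont f k (n + 1) + 1"
    using cont_euler[of f k 0 n 0] by simp
  then have "A (n + 1) * cont f k2 n = A (n + 1) * C n"
    using assms(3)[of n] assms(1,2) unfolding k by (simp add: algebra_simps)
  then show "cont f k2 n = C n" using assms(4) by simp
qed

lemma cont_0_1: "cont f 0 = (\<lambda>_. 1)" "cont f 1 = f"
  by auto

section \<open>Type A\<close>

text \<open>An SL2-tiling of the plane: with row \<open>n\<close> sheared, the mesh relation says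
  that adjacent 2 by 2 minors are 1. The position \<open>t\<close> runs over the universal cover of
  the cycle.\<close>

locale a_frieze =
  fixes p q :: int and Y :: "int \<Rightarrow> int \<Rightarrow> 'a::field"
  assumes mesh: "Y t (n + 1) * Y t n = 1 + Y (t - 1) (n + 1) * Y (t + 1) n"
    and glide: "Y (t + p + q) n = Y t (n + p)"
    and nz: "Y t n \<noteq> 0"
begin

definition J :: "int \<Rightarrow> 'a" where
  "J n = (Y 1 n + Y (- 1) n) / Y 0 n"

text \<open>Subtracting two neighbouring mesh relations shows that the quotient of the outer sum by
  the middle entry is constant on the diagonals where \<open>n + t\<close> is fixed.\<close>

lemma column: "Y (t + 1) n + Y (t - 1) n = J (n + t) * Y t n"
proof -
  define f :: "int \<Rightarrow> int \<Rightarrow> 'a" where "f t n = (Y (t + 1) (n - t) + Y (t - 1) (n - t)) / Y t (n - t)" for t n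
  have "f (t + 1) n = f t n" for t n
  proof -
    define m where "m = n - t - 1"
    have "Y (t + 1) m * (Y (t + 1) (m + 1) + Y (t - 1) (m + 1)) = Y t (m + 1) * (Y (t + 2) m + Y t m)"
      using mesh[of "t + 1" m] mesh[of t m] by (simp add: algebra_simps)
    then show ?thesis
      using nz[of t "m + 1"] nz[of "t + 1" m] by (simp add: f_def m_def field_simps)
  qed
  then have "f t n = f 0 n" for t n
    using periodic_mult[of "\<lambda>t. f t n" 1 0 t] by simp
  from this[of t "n + t"] show ?thesis
    using nz[of t n] nz[of 0 "n + t"] by (simp add: f_def J_def field_simps)
qed

text \<open>The glide identifies position \<open>p + q\<close> at time \<open>n - p\<close> with
  position 0 at time \<open>n\<close>; their diagonals differ by \<open>q\<close>.\<close>

lemma J_periodic: "J (n + q) = J n"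
proof -
  have g: "Y (t + (p + q)) (n - p) = Y t n" for t
    using glide[of t "n - p"] by (simp add: add.assoc)
  have "J (n - p + (0 + (p + q))) * Y (0 + (p + q)) (n - p) = Y (1 + (p + q)) (n - p) + Y (- 1 + (p + q)) (n - p)"
    using column[of "0 + (p + q)" "n - p"] by (simp add: algebra_simps)
  then have "J (n + q) * Y 0 n = J n * Y 0 n"
    using column[of 0 n] unfolding g by simp
  then show ?thesis using nz by simp
qed

theorem trace:
  assumes b: "b = p * k" "b = q * l"
  shows "(Y t (n + 2 * b) + Y t n) * Y s (m + b) = (Y s (m + 2 * b) + Y s m) * Y t (n + b)"
proof -
  \<comment> \<open>\<open>k\<close> rounds of the cycle shift time by \<open>p * k = b\<close>, and
    \<open>r\<close> is also \<open>q * (k + l)\<close>, a multiple of the period of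
    \<open>J\<close>.\<close>
  define r where "r = (p + q) * k"
  have glide': "Y (t + (p + q) * i) n = Y t (n + p * i)" for t n i
  proof -
    have "Y (t + (p + q) * i) (n - p * i) = Y (t + (p + q) * 0) (n - p * 0)" for n
      using periodic_mult[of "\<lambda>i. Y (t + (p + q) * i) (n - p * i)" 1 0 i] glide[of "t + (p + q) * _" "n - p * _ - p"]
      by (simp add: algebra_simps)
    from this[of "n + p * i"] show ?thesis by simp
  qed
  have r: "r = q * (k + l)" using b by (simp add: r_def algebra_simps)
  have Y: "Y t (n + b) = Y (t + r) n" "Y t (n + 2 * b) = Y (t + 2 * r) n" for t n
    using glide'[of t k n] glide'[of t "2 * k" n] b(1) by (simp_all add: r_def algebra_simps)
  have "(Y (t + 2 * r) n + Y (t + 0) n) * Y (s + r) m = (Y (s + 2 * r) m + Y (s + 0) m) * Y (t + r) n"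
  proof (rule hill[of J r _ "n + t" _ "m + s"])
    show "J (i + r) = J i" for i
      unfolding r by (rule periodic_mult) (rule J_periodic)
    show "Y (t + (i + 1)) n + Y (t + (i - 1)) n = J (i + (n + t)) * Y (t + i) n" for i
      using column[of "t + i" n] by (simp add: algebra_simps)
    show "Y (s + (i + 1)) m + Y (s + (i - 1)) m = J (i + (m + s)) * Y (s + i) m" for i
      using column[of "s + i" m] by (simp add: algebra_simps)
  qed (rule nz)+
  then show ?thesis unfolding Y by simp
qed

end

section \<open>Type D\<close>

text \<open>
  The sequences \<open>x\<close>, \<open>x'\<close> and \<open>y\<close>, \<open>y'\<close> live at the two pairs of leaves. Each pair enters the
  mesh relations of the chain between them as a product, so that it acts as one end \<open>U 0\<close> or \<open>U r\<close>
  of the chain.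
\<close>

locale d_frieze =
  fixes r :: nat and x x' y y' :: "int \<Rightarrow> 'a::field" and U :: "nat \<Rightarrow> int \<Rightarrow> 'a"
  assumes r: "2 \<le> r"
    and mesh: "0 < k \<Longrightarrow> k < r \<Longrightarrow> U k (n + 1) * U k n = 1 + U (k - 1) (n + 1) * U (k + 1) n"
    and U0: "U 0 n = x n * x' n" and Ur: "U r n = y n * y' n"
    and x: "x (n + 1) * x n = 1 + U 1 n" and x': "x' (n + 1) * x' n = 1 + U 1 n"
    and y: "y (n + 1) * y n = 1 + U (r - 1) (n + 1)" and y': "y' (n + 1) * y' n = 1 + U (r - 1) (n + 1)"
    and nz: "x n \<noteq> 0" "x' n \<noteq> 0" "y n \<noteq> 0" "y' n \<noteq> 0"
    and nzU: "k \<le> r \<Longrightarrow> U k n \<noteq> 0"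
begin

text \<open>Reading the chain from the other end reverses its arrows; delaying the entry at distance
  \<open>k\<close> by \<open>k\<close> restores the form of the mesh relation. The old near leaves,
  now at distance \<open>r\<close>, are delayed by \<open>r\<close>.\<close>

lemma mirror:
  "d_frieze r y y' (\<lambda>n. x (n + int r)) (\<lambda>n. x' (n + int r)) (\<lambda>k n. U (r - k) (n + int k))"
proof
  fix k n
  assume k: "0 < k" "k < r"
  then have "r - k - 1 = r - (k + 1)" "r - k + 1 = r - (k - 1)" "int (k - 1) = int k - 1"
    by auto
  then show "U (r - k) (n + 1 + int k) * U (r - k) (n + int k) =
      1 + U (r - (k - 1)) (n + 1 + int (k - 1)) * U (r - (k + 1)) (n + int (k + 1))"
    using mesh[of "r - k" "n + int k"] k by (simp add: algebra_simps)
next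
  fix n
  have "r - (r - 1) = 1" "n + 1 + int (r - 1) = n + int r" using r by auto
  then show "x (n + 1 + int r) * x (n + int r) = 1 + U (r - (r - 1)) (n + 1 + int (r - 1))"
    "x' (n + 1 + int r) * x' (n + int r) = 1 + U (r - (r - 1)) (n + 1 + int (r - 1))"
    using x[of "n + int r"] x'[of "n + int r"] by (simp_all add: algebra_simps)
qed (use r U0 Ur y y' nz nzU in auto)

definition J :: "int \<Rightarrow> 'a" where
  "J n = (x (n + 1) + x (n - 1)) / x' n"

text \<open>The right-hand sides for \<open>x\<close> and \<open>x'\<close> agree, so
  \<open>x (n + 1) * x n = x' (n + 1) * x' n\<close>: the roles of the two leaves are exchanged in
  each step of time. Hence Hill's equation holds for the alternating sequence, not for either leaf
  alone.\<close>

lemma leaf: "x (n + 1) + x (n - 1) = J n * x' n" "x' (n + 1) + x' (n - 1) = J n * x n"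
proof -
  show 1: "x (n + 1) + x (n - 1) = J n * x' n"
    by (simp add: J_def nz)
  have "x (n + 1) * x n = x' (n + 1) * x' n" "x n * x (n - 1) = x' n * x' (n - 1)"
    using x[of n] x'[of n] x[of "n - 1"] x'[of "n - 1"] by simp_all
  then have "x' n * (x' (n + 1) + x' (n - 1)) = x' n * (J n * x n)"
    using 1 by algebra
  then show "x' (n + 1) + x' (n - 1) = J n * x n" using nz(2) by simp
qed

lemma U2: "U 2 n = x' n * x (n + 2) - J (n + 1)"
proof -
  have "U 1 (n + 1) * U 1 n = 1 + U 0 (n + 1) * U 2 n"
    using mesh[of 1 n] r by (simp add: numeral_2_eq_2)
  moreover have "x (n + 2) * x (n + 1) = 1 + U 1 (n + 1)"
    using x[of "n + 1"] by (simp add: add.assoc)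
  moreover have "x (n + 2) + x n = J (n + 1) * x' (n + 1)"
    using leaf(1)[of "n + 1"] by (simp add: add.assoc)
  ultimately have "x (n + 1) * x' (n + 1) * U 2 n = x (n + 1) * x' (n + 1) * (x' n * x (n + 2) - J (n + 1))"
    using x[of n] x'[of n] U0[of "n + 1"] by algebra
  then show ?thesis using nz by simp
qed

text \<open>Neighbouring mesh relations propagate the quotient along the chain as in type A; the
  leaves enter only through the base case. In \<open>row\<close> the same happens along the other
  diagonal, and there the index of \<open>J\<close> does not move with \<open>k\<close>.\<close>

lemma column: "U (k + 2) n + U k n = J (n + int k + 1) * U (k + 1) n" if "k + 2 \<le> r"
  using that
proof (induction k arbitrary: n)
  case 0
  then show ?case using U2[of n] U0[of n] x'[of n] leaf(1)[of "n + 1"] by (simp add: numeral_2_eq_2 add.assoc) algebra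
next
  case (Suc k)
  have "U (k + 1) (n + 1) * (U (k + 3) n + U (k + 1) n) = U (k + 2) n * (U (k + 2) (n + 1) + U k (n + 1))"
    using mesh[of "k + 2" n] mesh[of "k + 1" n] Suc.prems by (simp add: algebra_simps eval_nat_numeral)
  also have "\<dots> = U (k + 1) (n + 1) * (J (n + int k + 2) * U (k + 2) n)"
    using Suc.IH[of "n + 1"] Suc.prems by (simp add: algebra_simps)
  finally have "U (k + 3) n + U (k + 1) n = J (n + int k + 2) * U (k + 2) n"
    using nzU[of "k + 1" "n + 1"] Suc.prems by simp
  then show ?case by (simp add: algebra_simps eval_nat_numeral)
qed

lemma row: "U (k + 2) (n - 1) + U k (n + 1) = J n * U (k + 1) n" if "k + 2 \<le> r"
  using that
proof (induction k arbitrary: n)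
  case 0
  have "U 2 (n - 1) = x' (n - 1) * x (n + 1) - J n"
    using U2[of "n - 1"] by (simp add: add.commute)
  then have "U 2 (n - 1) + U 0 (n + 1) = J n * U 1 n"
    using U0[of "n + 1"] x[of n] leaf(2)[of n] by algebra
  then show ?case by (simp add: numeral_2_eq_2)
next
  case (Suc k)
  have "U (k + 1) n * (U (k + 3) (n - 1) + U (k + 1) (n + 1)) = U (k + 2) n * (U (k + 2) (n - 1) + U k (n + 1))"
    using mesh[of "k + 2" "n - 1"] mesh[of "k + 1" n] Suc.prems by (simp add: algebra_simps eval_nat_numeral)
  also have "\<dots> = U (k + 1) n * (J n * U (k + 2) n)"
    using Suc.IH[of n] Suc.prems by (simp add: algebra_simps)
  finally have "U (k + 3) (n - 1) + U (k + 1) (n + 1) = J n * U (k + 2) n"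
    using nzU[of "k + 1" n] Suc.prems by simp
  then show ?case by (simp add: algebra_simps eval_nat_numeral)
qed

text \<open>Reflection interchanges \<open>row\<close> and \<open>column\<close>. Beside the far
  leaves, the coefficient belonging to that end is thus computed once from each, with indices of
  \<open>J\<close> that differ by the length \<open>r\<close> of the chain.\<close>

lemma J_mirror: "d_frieze.J y y' n = J n" "d_frieze.J y y' n = J (n + int r)"
proof -
  interpret m: d_frieze r y y' "\<lambda>n. x (n + int r)" "\<lambda>n. x' (n + int r)" "\<lambda>k n. U (r - k) (n + int k)"
    by (rule mirror)
  obtain k where k: "r = k + 2" using r by (metis le_add_diff_inverse2)
  show "m.J n = J n"
    using m.column[of 0 "n - 1"] row[of k n] r nzU[of "r - 1" n] by (simp add: k algebra_simps)
  show "m.J n = J (n + int r)"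
    using m.row[of 0 n] column[of k "n + 1"] r nzU[of "r - 1" "n + 1"] by (simp add: k algebra_simps)
qed

lemma J_periodic: "J (n + int r) = J n"
  using J_mirror by simp

definition leaf_seq :: "bool \<Rightarrow> int \<Rightarrow> int \<Rightarrow> 'a" where
  "leaf_seq c s = (if c then (if even s then x else x') else (if even s then y else y'))"

lemma leaf_seq_nz: "leaf_seq c s n \<noteq> 0"
  by (simp add: leaf_seq_def nz)

lemma leaf_seq_relation: "leaf_seq c (s + 1) (n + 1) + leaf_seq c (s - 1) (n - 1) = J n * leaf_seq c s n"
  using leaf[of n] d_frieze.leaf[OF mirror, of n] J_mirror(1)[of n] by (simp add: leaf_seq_def)

text \<open>Evenness of \<open>b\<close> brings the alternation within a pair back to the leaf where
  it started.\<close>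

theorem trace:
  assumes b: "even b" "b = int r * k"
  shows "(leaf_seq c s (n + 2 * b) + leaf_seq c s n) * leaf_seq d t (m + b)
    = (leaf_seq d t (m + 2 * b) + leaf_seq d t m) * leaf_seq c s (n + b)"
proof -
  have per: "J (i + b) = J i" for i
    unfolding b(2) by (rule periodic_mult) (rule J_periodic)
  have step: "leaf_seq c (s + (i + 1)) (n + (i + 1)) + leaf_seq c (s + (i - 1)) (n + (i - 1))
      = J (i + n) * leaf_seq c (s + i) (n + i)" for c s n i
    using leaf_seq_relation[of c "s + i" "n + i"] by (simp add: algebra_simps)
  have "(leaf_seq c (s + 2 * b) (n + 2 * b) + leaf_seq c (s + 0) (n + 0)) * leaf_seq d (t + b) (m + b)
      = (leaf_seq d (t + 2 * b) (m + 2 * b) + leaf_seq d (t + 0) (m + 0)) * leaf_seq c (s + b) (n + b)"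
    by (rule hill[of J b _ n _ m]) (simp_all only: step per leaf_seq_nz not_False_eq_True)
  moreover have "leaf_seq c (s + b) = leaf_seq c s" "leaf_seq c (s + 2 * b) = leaf_seq c s" for c s
    using b(1) by (simp_all add: leaf_seq_def)
  ultimately show ?thesis by simp
qed

end

section \<open>Types E\<close>

text \<open>
  The sequences \<open>x\<close>, \<open>y\<close>, \<open>z\<close> are those at the leaves, and \<open>cont x k\<close> is the sequence at the \<open>k\<close>-th
  vertex of the arm of \<open>x\<close>, counted from the leaf. One step beyond the central vertex the
  continuant is the product of the neighbours of the centre on the other two arms.
\<close>

locale e6_frieze =
  fixes x y z :: "int \<Rightarrow> 'a::field"
  assumes center: "cont x 3 n = cont y 3 n" "cont x 3 n = cont z 3 n"
    and x4: "cont x 4 n = cont y 2 (n + 1) * cont z 2 (n + 1)"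
    and y4: "cont y 4 n = cont z 2 (n + 1) * cont x 2 (n + 1)"
    and z4: "cont z 4 n = cont x 2 (n + 1) * cont y 2 (n + 1)"
    and nz: "x n \<noteq> 0" "y n \<noteq> 0" "z n \<noteq> 0" "cont x 3 n \<noteq> 0"
begin

text \<open>Allows the identities to be proved at a fixed time, with numerals as indices, and then
  transported to every \<open>n\<close>.\<close>

lemma shift: "e6_frieze (\<lambda>i. x (i + m)) (\<lambda>i. y (i + m)) (\<lambda>i. z (i + m))"
  using center x4[of "_ + m"] y4[of "_ + m"] z4[of "_ + m"] nz
  by unfold_locales (simp_all add: cont_shift ac_simps)

lemma rotate: "e6_frieze y z x"
  using center x4 y4 z4 nz by unfold_locales simp_all

text \<open>Multiplied by the centre at time -1, \<open>y 2\<close> and \<open>z (- 2)\<close>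
  become entries one step beyond the centre plus arm entries. After factoring these,
  \<open>x 0\<close> divides the sum, and the cofactor is the numerator that defines
  \<open>J\<close>.\<close>

lemma leaf_0:
  assumes "J * cont x 3 (- 1) = x 1 * cont z 2 0 + x (- 1) * cont y 2 (- 1)"
  shows "y 2 + z (- 2) = J * x 0"
proof -
  have "y 2 * cont y 3 (- 1) = cont y 4 (- 1) + cont y 2 (- 1)"
    by (simp add: cont_expand)
  moreover have "z (- 2) * cont z 3 (- 1) = cont z 4 (- 2) + cont z 2 0"
    by (simp add: cont_expand) algebra
  moreover have "cont x 2 0 = x 0 * x 1 - 1" "cont x 2 (- 1) = x (- 1) * x 0 - 1"
    by (simp_all add: cont_expand)
  ultimately have "cont x 3 (- 1) * (y 2 + z (- 2)) = cont x 3 (- 1) * (J * x 0)"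
    using assms center[of "- 1"] y4[of "- 1"] z4[of "- 2"] by simp algebra
  then show ?thesis using nz(4) by simp
qed

text \<open>\<open>J'\<close> is the coefficient of the rotated frieze (\<open>y\<close>,
  \<open>z\<close>, \<open>x\<close>) at time 1. Passing to the next leaf thus moves the index by
  one, and three rotations give period 3.\<close>

lemma rotate_0:
  assumes "J * cont x 3 (- 1) = x 1 * cont z 2 0 + x (- 1) * cont y 2 (- 1)"
    and "J' * cont x 3 0 = y 2 * cont x 2 1 + y 0 * cont z 2 0"
  shows "J = J'"
proof -
  have "y 2 * cont y 3 (- 1) = cont y 4 (- 1) + cont y 2 (- 1)"
    "y 0 * cont y 3 (- 1) = cont y 2 (- 1) * cont y 2 0 - 1"
    "x 1 * cont x 3 0 = cont x 2 0 * cont x 2 1 - 1"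
    "x (- 1) * cont x 3 0 = cont x 4 (- 1) + cont x 2 1"
    by (simp add: cont_expand; algebra)+
  then have "cont x 3 (- 1) * cont x 3 0 * J = cont x 3 (- 1) * cont x 3 0 * J'"
    using assms center[of "- 1"] y4[of "- 1"] x4[of "- 1"] by simp algebra
  then show ?thesis using nz(4) by simp
qed

definition J :: "int \<Rightarrow> 'a" where
  "J n = (x (n + 1) * cont z 2 n + x (n - 1) * cont y 2 (n - 1)) / cont x 3 (n - 1)"

lemma J_center: "J n * cont x 3 (n - 1) = x (n + 1) * cont z 2 n + x (n - 1) * cont y 2 (n - 1)"
  by (simp add: J_def nz)

lemma leaf: "y (n + 2) + z (n - 2) = J n * x n"
  using e6_frieze.leaf_0[OF shift[of n], of "J n"] J_center[of n]
  by (simp add: cont_shift algebra_simps)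

lemma J_rotate: "J n = e6_frieze.J y z x (n + 1)"
  using e6_frieze.rotate_0[OF shift[of n], of "J n" "e6_frieze.J y z x (n + 1)"] J_center[of n]
    e6_frieze.J_center[OF rotate, of "n + 1"] center(1)[of n]
  by (simp add: cont_shift algebra_simps)

lemma J_periodic: "J (n + 3) = J n"
  using J_rotate[of n] e6_frieze.J_rotate[OF rotate, of "n + 1"]
    e6_frieze.J_rotate[OF e6_frieze.rotate[OF rotate], of "n + 2"]
  by (simp add: add.assoc)

definition leaf_seq :: "int \<Rightarrow> int \<Rightarrow> 'a" where
  "leaf_seq s n = (if s mod 3 = 0 then x n else if s mod 3 = 1 then y n else z n)"

lemma leaf_seq_nz: "leaf_seq s n \<noteq> 0"
  by (simp add: leaf_seq_def nz)

text \<open>The next leaf is reached after two units of time and its coefficient lags by one, so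
  \<open>n - s\<close> advances by exactly one per step.\<close>

lemma leaf_seq_relation: "leaf_seq (s + 1) (n + 2) + leaf_seq (s - 1) (n - 2) = J (n - s) * leaf_seq s n"
proof -
  have J: "J (n - s) = J (n - s mod 3)"
    using periodic_mult[of J 3 "n - s" "s div 3", OF J_periodic] by (simp add: algebra_simps minus_mod_eq_mult_div[symmetric])
  have y: "z (n + 2) + x (n - 2) = J (n - 1) * y n"
    using e6_frieze.leaf[OF rotate, of n] J_rotate[of "n - 1"] by simp
  have z: "x (n + 2) + y (n - 2) = J (n - 2) * z n"
    using e6_frieze.leaf[OF e6_frieze.rotate[OF rotate], of n]
      e6_frieze.J_rotate[OF rotate, of "n - 1"] J_rotate[of "n - 2"] by simp
  consider "s mod 3 = 0" | "s mod 3 = 1" | "s mod 3 = 2" by fastforce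
  then show ?thesis
    using leaf[of n] y z unfolding J leaf_seq_def
      mod_add_left_eq[of s 3 1, symmetric] mod_diff_left_eq[of s 3 1, symmetric]
    by cases (simp_all add: add.commute)
qed

theorem trace:
  "(leaf_seq s (n + 12) + leaf_seq s n) * leaf_seq t (m + 6)
    = (leaf_seq t (m + 12) + leaf_seq t m) * leaf_seq s (n + 6)"
proof -
  have step: "leaf_seq (s + (i + 1)) (n + 2 * (i + 1)) + leaf_seq (s + (i - 1)) (n + 2 * (i - 1))
      = J (i + (n - s)) * leaf_seq (s + i) (n + 2 * i)" for s n i
    using leaf_seq_relation[of "s + i" "n + 2 * i"] by (simp add: algebra_simps)
  have "(leaf_seq (s + 2 * 3) (n + 2 * (2 * 3)) + leaf_seq (s + 0) (n + 2 * 0)) * leaf_seq (t + 3) (m + 2 * 3)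
      = (leaf_seq (t + 2 * 3) (m + 2 * (2 * 3)) + leaf_seq (t + 0) (m + 2 * 0)) * leaf_seq (s + 3) (n + 2 * 3)"
    by (rule hill[of J 3 _ "n - s" _ "m - t"]) (simp_all only: step J_periodic leaf_seq_nz not_False_eq_True)
  moreover have "leaf_seq (s + 3) = leaf_seq s" "leaf_seq (s + 6) = leaf_seq s" for s
  proof -
    have "(s + 3) mod 3 = s mod 3" "(s + 6) mod 3 = s mod 3" by presburger+
    then show "leaf_seq (s + 3) = leaf_seq s" "leaf_seq (s + 6) = leaf_seq s"
      unfolding leaf_seq_def by (simp_all only:)
  qed
  ultimately show ?thesis by simp
qed

end

section \<open>Type E7: two long arms and one short arm\<close>

locale e7_frieze =
  fixes x y z :: "int \<Rightarrow> 'a::field"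
  assumes center: "cont x 4 n = cont y 4 n"
    and zz: "z n * z (n + 1) = 1 + cont x 4 n"
    and x5: "cont x 5 n = cont y 3 (n + 1) * z (n + 1)"
    and y5: "cont y 5 n = cont x 3 (n + 1) * z (n + 1)"
    and nz: "x n \<noteq> 0" "y n \<noteq> 0" "z n \<noteq> 0" "cont x 3 n \<noteq> 0" "cont y 3 n \<noteq> 0" "cont x 4 n \<noteq> 0"
begin

lemma shift: "e7_frieze (\<lambda>i. x (i + m)) (\<lambda>i. y (i + m)) (\<lambda>i. z (i + m))"
  using center zz[of "_ + m"] x5[of "_ + m"] y5[of "_ + m"] nz
  by unfold_locales (simp_all add: cont_shift ac_simps)

lemma swap: "e7_frieze y x z"
  using center zz x5 y5 nz by unfold_locales simp_all

text \<open>Since the centre is \<open>cont z 2\<close>, both equations say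
  \<open>cont z 3 (- 2) = cont x 3 (- 1) * cont y 3 (- 1)\<close>, expanded at the left and at the
  right end.\<close>

lemma center_z:
  "cont x 4 (- 1) * z (- 2) = z 0 + cont x 3 (- 1) * cont y 3 (- 1)"
  "cont x 4 (- 2) * z 0 = z (- 2) + cont x 3 (- 1) * cont y 3 (- 1)"
proof -
  have "cont x 4 (- 2) * cont x 4 (- 1) = cont x 5 (- 2) * cont x 3 (- 1) + 1"
    using cont_euler[of x 3 0 "- 2" 0] by simp
  then have "z (- 1) * (cont x 4 (- 1) * z (- 2)) = z (- 1) * (z 0 + cont x 3 (- 1) * cont y 3 (- 1))"
    "z (- 1) * (cont x 4 (- 2) * z 0) = z (- 1) * (z (- 2) + cont x 3 (- 1) * cont y 3 (- 1))"
    using zz[of "- 1"] zz[of "- 2"] x5[of "- 2"] by (simp, algebra)+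
  then show "cont x 4 (- 1) * z (- 2) = z 0 + cont x 3 (- 1) * cont y 3 (- 1)"
    "cont x 4 (- 2) * z 0 = z (- 2) + cont x 3 (- 1) * cont y 3 (- 1)"
    using nz(3) by simp_all
qed

text \<open>The denominator of \<open>J\<close> is moved from \<open>z (- 1)\<close> to
  \<open>cont x 3 (- 1)\<close> and on to the centre at two consecutive times, where the arm of
  \<open>y\<close> becomes visible.\<close>

lemma J_x4:
  assumes J: "z (- 1) * J = cont x 2 1 + cont x 2 (- 2)"
  shows "J * cont x 4 (- 1) = z 0 * cont x 2 1 + cont y 3 (- 1) * x (- 1)"
    and "J * cont x 4 (- 2) = z (- 2) * cont x 2 (- 2) + cont y 3 (- 1) * x 1"
proof -
  have e: "cont x 3 (- 1) * cont x 2 1 = cont x 4 (- 1) * x 1 + x (- 1)"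
    "cont x 3 (- 1) * cont x 2 (- 2) = cont x 4 (- 2) * x (- 1) + x 1"
    by (simp add: cont_expand; algebra)+
  then have "z (- 1) * (J * cont x 3 (- 1)) = z (- 1) * (z 0 * x 1 + z (- 2) * x (- 1))"
    using J zz[of "- 1"] zz[of "- 2"] by simp algebra
  then have x3: "J * cont x 3 (- 1) = z 0 * x 1 + z (- 2) * x (- 1)"
    using nz(3) by simp
  have "cont x 3 (- 1) * (J * cont x 4 (- 1)) = cont x 3 (- 1) * (z 0 * cont x 2 1 + cont y 3 (- 1) * x (- 1))"
    using x3 e(1) center_z(1) by algebra
  then show "J * cont x 4 (- 1) = z 0 * cont x 2 1 + cont y 3 (- 1) * x (- 1)"
    using nz(4) by simp
  have "cont x 3 (- 1) * (J * cont x 4 (- 2)) = cont x 3 (- 1) * (z (- 2) * cont x 2 (- 2) + cont y 3 (- 1) * x 1)"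
    using x3 e(2) center_z(2) by algebra
  then show "J * cont x 4 (- 2) = z (- 2) * cont x 2 (- 2) + cont y 3 (- 1) * x 1"
    using nz(4) by simp
qed

lemma leaf_0:
  assumes J: "z (- 1) * J = cont x 2 1 + cont x 2 (- 2)"
  shows "y 3 + y (- 3) = J * x 0"
proof -
  have y: "cont x 4 (- 1) * y 3 = cont x 3 0 * z 0 + cont y 3 (- 1)"
    "cont x 4 (- 2) * y (- 3) = cont x 3 (- 2) * z (- 2) + cont y 3 (- 1)"
    using center y5[of "- 1"] y5[of "- 3"] cont_expand(4)[of y "- 1"] cont_left[of y 3 "- 3"]
    by (simp_all add: algebra_simps)
  have x: "x 0 * cont x 2 1 = cont x 3 0 + x 2" "x 0 * x (- 1) = cont x 2 (- 1) + 1"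
    "x 2 * cont x 3 (- 1) = cont x 2 (- 1) + cont x 4 (- 1)"
    by (simp add: cont_expand; algebra)+
  have "cont x 3 (- 2) * cont x 4 (- 1) = cont x 5 (- 2) * cont x 2 (- 1) + x 2"
    using cont_euler[of x 2 0 "- 2" 1] by simp
  then have x': "cont x 4 (- 1) * cont x 3 (- 2) = cont y 3 (- 1) * z (- 1) * cont x 2 (- 1) + x 2"
    using x5[of "- 2"] by simp algebra
  \<comment> \<open>The bracket on the left is what remains of
    \<open>x 0 * (J * cont x 4 (- 1))\<close> after subtracting \<open>cont x 4 (- 1) * y 3\<close>;
    it has to account for \<open>y (- 3)\<close>.\<close>
  have "cont x 4 (- 2) * (z 0 * x 2 + cont y 3 (- 1) * cont x 2 (- 1))
      = cont x 4 (- 1) * (cont x 3 (- 2) * z (- 2) + cont y 3 (- 1))"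
    using x' x(3) zz[of "- 2"] center_z(2) by simp algebra
  then have "cont x 4 (- 2) * (x 0 * (J * cont x 4 (- 1)))
      = cont x 4 (- 2) * (cont x 4 (- 1) * (y 3 + y (- 3)))"
    unfolding J_x4(1)[OF J] using x y by algebra
  then show ?thesis using nz(6) by (simp add: mult.commute mult.left_commute)
qed

text \<open>\<open>J'\<close> is the coefficient of the swapped frieze at time 2. Over the centre at
  times -1 and 0 the two become comparable; swapping twice gives period 4.\<close>

lemma swap_0:
  assumes J: "z (- 1) * J = cont x 2 1 + cont x 2 (- 2)"
    and J': "z 1 * J' = cont y 2 3 + cont y 2 0"
  shows "J = J'"
proof -
  have 1: "J * cont x 4 (- 1) = z 0 * cont x 2 1 + cont y 3 (- 1) * x (- 1)"
    using J_x4(1)[OF J] .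
  have 2: "J' * cont x 4 0 = z 0 * cont y 2 0 + cont x 3 1 * y 3"
    using e7_frieze.J_x4(2)[OF e7_frieze.shift[OF swap], of 2 J'] J'
    by (simp add: cont_shift center)
  have "cont x 4 (- 1) * y 3 = cont x 3 0 * z 0 + cont y 3 (- 1)"
    using center[of "- 1"] y5[of "- 1"] cont_expand(4)[of y "- 1"] by (simp add: algebra_simps)
  moreover have "cont x 4 0 * x (- 1) = cont y 3 0 * z 0 + cont x 3 1"
    using x5[of "- 1"] cont_left[of x 3 "- 1"] by (simp add: algebra_simps)
  moreover have "cont x 4 0 * cont x 2 1 = cont x 3 0 * cont x 3 1 - 1"
    using cont_euler[of x 2 0 0 0] by simp
  moreover have "cont x 4 (- 1) * cont y 2 0 = cont y 3 (- 1) * cont y 3 0 - 1"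
    using cont_euler[of y 2 0 "- 1" 0] center[of "- 1"] by simp
  ultimately have "cont x 4 (- 1) * cont x 4 0 * J = cont x 4 (- 1) * cont x 4 0 * J'"
    using 1 2 by algebra
  then show ?thesis using nz(6) by simp
qed

definition J :: "int \<Rightarrow> 'a" where
  "J n = (cont x 2 (n + 1) + cont x 2 (n - 2)) / z (n - 1)"

lemma J_z: "z (n - 1) * J n = cont x 2 (n + 1) + cont x 2 (n - 2)"
  by (simp add: J_def nz)

lemma leaf: "y (n + 3) + y (n - 3) = J n * x n"
  using e7_frieze.leaf_0[OF shift[of n], of "J n"] J_z[of n]
  by (simp add: cont_shift algebra_simps)

lemma J_swap: "J n = e7_frieze.J y z (n + 2)"
  using e7_frieze.swap_0[OF shift[of n], of "J n" "e7_frieze.J y z (n + 2)"] J_z[of n]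
    e7_frieze.J_z[OF swap, of "n + 2"]
  by (simp add: cont_shift algebra_simps)

lemma J_periodic: "J (n + 4) = J n"
  using J_swap[of n] e7_frieze.J_swap[OF swap, of "n + 2"] by (simp add: add.assoc)

definition leaf_seq :: "int \<Rightarrow> int \<Rightarrow> 'a" where
  "leaf_seq s n = (if even s then x n else y n)"

lemma leaf_seq_nz: "leaf_seq s n \<noteq> 0"
  by (simp add: leaf_seq_def nz)

lemma leaf_seq_relation: "leaf_seq (s + 1) (n + 3) + leaf_seq (s - 1) (n - 3) = J (n + 2 * s) * leaf_seq s n"
proof (cases "even s")
  case True
  then obtain k where "s = 2 * k" by blast
  then show ?thesis
    using leaf[of n] periodic_mult[of J 4 n k, OF J_periodic] by (simp add: leaf_seq_def)
next
  case False
  then obtain k where k: "s = 2 * k + 1" by (elim oddE)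
  have "J (n + 2) = e7_frieze.J y z n"
    using e7_frieze.J_swap[OF swap, of n] by simp
  then show ?thesis
    using e7_frieze.leaf[OF swap, of n] periodic_mult[of J 4 "n + 2" k, OF J_periodic]
    by (simp add: leaf_seq_def k algebra_simps)
qed

theorem trace:
  "(leaf_seq s (n + 24) + leaf_seq s n) * leaf_seq t (m + 12)
    = (leaf_seq t (m + 24) + leaf_seq t m) * leaf_seq s (n + 12)"
proof -
  \<comment> \<open>The index of \<open>J\<close> grows by 3 + 2 = 5 per step, which is 1 modulo the
    period 4.\<close>
  have step: "leaf_seq (s + (i + 1)) (n + 3 * (i + 1)) + leaf_seq (s + (i - 1)) (n + 3 * (i - 1))
      = J (i + (n + 2 * s)) * leaf_seq (s + i) (n + 3 * i)" for s n i
    using leaf_seq_relation[of "s + i" "n + 3 * i"]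
      periodic_mult[of J 4 "i + (n + 2 * s)" i, OF J_periodic] by (simp add: algebra_simps)
  have "(leaf_seq (s + 2 * 4) (n + 3 * (2 * 4)) + leaf_seq (s + 0) (n + 3 * 0)) * leaf_seq (t + 4) (m + 3 * 4)
      = (leaf_seq (t + 2 * 4) (m + 3 * (2 * 4)) + leaf_seq (t + 0) (m + 3 * 0)) * leaf_seq (s + 4) (n + 3 * 4)"
    by (rule hill[of J 4 _ "n + 2 * s" _ "m + 2 * t"]) (simp_all only: step J_periodic leaf_seq_nz not_False_eq_True)
  then show ?thesis by (simp add: leaf_seq_def)
qed

end

section \<open>Type E8: a single extending vertex\<close>

locale e8_frieze =
  fixes x y z :: "int \<Rightarrow> 'a::field"
  assumes center: "cont x 6 n = cont y 3 n"
    and zz: "z n * z (n + 1) = 1 + cont x 6 n"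
    and x7: "cont x 7 n = cont y 2 (n + 1) * z (n + 1)"
    and y4: "cont y 4 n = cont x 5 (n + 1) * z (n + 1)"
    and nz: "x n \<noteq> 0" "cont x 5 n \<noteq> 0" "cont x 6 n \<noteq> 0"
      "cont y 2 n \<noteq> 0" "z n \<noteq> 0"
begin

text \<open>The continuant relation of the short arm,
  \<open>cont z 3 (- 1) = cont x 5 0 * cont y 2 0\<close>, expanded at the left end.\<close>

lemma x6_z_0: "cont x 6 0 * z (- 1) = z 1 + cont x 5 0 * cont y 2 0"
proof -
  have e: "cont x 6 (- 1) * cont x 6 0 = cont x 5 0 * cont x 7 (- 1) + 1"
    using cont_euler[of x 5 0 "- 1" 0] by (simp add: mult.commute)
  have "z 0 * (cont x 6 0 * z (- 1)) = z 0 * (z 1 + cont x 5 0 * cont y 2 0)"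
    using e zz[of 0] zz[of "- 1"] x7[of "- 1"] by simp algebra
  then show ?thesis using nz(5) by simp
qed

text \<open>One of several products linking different arms; \<open>x5_y\<close>, \<open>x_y2\<close>
  and \<open>y_x\<close> follow the same scheme: multiply by an entry to which the mesh relations
  apply, then cancel it.\<close>

lemma z_y: "z 0 * y 3 = cont x 5 1 + x (- 1)"
proof -
  have e: "x (- 1) * cont x 6 0 = cont x 7 (- 1) + cont x 5 1"
    using cont_left[of x 5 "- 1"] by simp
  have "y 3 * cont y 3 0 = cont y 4 0 + cont y 2 0" by (simp add: cont_expand)
  then have "cont x 6 0 * (z 0 * y 3) = cont x 6 0 * (cont x 5 1 + x (- 1))"
    using e zz[of 0] x7[of "-1"] y4[of 0] center[of 0] by simp algebra
  then show ?thesis using nz(3) by simp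
qed

lemma shift: "e8_frieze (\<lambda>i. x (i + m)) (\<lambda>i. y (i + m)) (\<lambda>i. z (i + m))"
  using center zz[of "_ + m"] x7[of "_ + m"] y4[of "_ + m"] nz
  by unfold_locales (simp_all add: cont_shift ac_simps)

text \<open>
  Reversal of time is a symmetry: the continuants, being palindromic, turn into each other, and
  the offsets of \<open>y\<close> and \<open>z\<close> make up for their lengths.
\<close>

lemma mirror: "e8_frieze (\<lambda>i. x (0 - i)) (\<lambda>i. y (- 3 - i)) (\<lambda>i. z (- 4 - i))"
proof unfold_locales
  fix n
  have i: "- 4 - n = - 5 - n + 1" "- 4 - (n + 1) = - 5 - n" "0 - n - int 6 + 1 = - 5 - n"
    "- 3 - n - int 3 + 1 = - 5 - n"  "0 - n - int 7 + 1 = - 6 - n"  "- 3 - n - int 4 + 1 = - 6 - n"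
    "- 3 - (n + 1) - int 2 + 1 = - 6 - n + 1" "0 - (n + 1) - int 5 + 1 = - 6 - n + 1" "- 5 - n = - 6 - n + 1"
    by simp_all
  show "z (- 4 - n) * z (- 4 - (n + 1)) = 1 + cont (\<lambda>i. x (0 - i)) 6 n"
    unfolding cont_mirror i(1-3) using zz[of "- 5 - n"] by (simp only: mult.commute)
  show "cont (\<lambda>i. x (0 - i)) 6 n = cont (\<lambda>i. y (- 3 - i)) 3 n"
    unfolding cont_mirror i(3,4) by (rule center)
  show "cont (\<lambda>i. x (0 - i)) 7 n = cont (\<lambda>i. y (- 3 - i)) 2 (n + 1) * z (- 4 - (n + 1))"
    unfolding cont_mirror i(2,5,7) i(9) by (rule x7)
  show "cont (\<lambda>i. y (- 3 - i)) 4 n = cont (\<lambda>i. x (0 - i)) 5 (n + 1) * z (- 4 - (n + 1))"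
    unfolding cont_mirror i(2,6,8) i(9) by (rule y4)
qed (simp_all only: cont_mirror nz not_False_eq_True)

lemma x6_z: "cont x 6 n * z (n - 1) = z (n + 1) + cont x 5 n * cont y 2 n"
  using e8_frieze.x6_z_0[OF shift[of n]] by (simp add: cont_shift algebra_simps)

lemmas x6_z' = x6_z[of "- 2", simplified]
lemmas x6_z_mirror = e8_frieze.x6_z[OF mirror, of "- 2", simplified cont_mirror, simplified]
lemmas z_y' = e8_frieze.z_y[OF shift[of "- 2"], simplified cont_shift, simplified]

lemma x5_y: "cont x 5 (- 2) * y 1 = cont x 4 (- 1) * z (- 1) + z (- 3)"
proof -
  have "cont x 5 (- 2) * x (- 3) = cont x 6 (- 3) + cont x 4 (- 1)"
    by (simp add: cont_expand) algebra
  moreover have "cont x 5 (- 2) * cont x 5 (- 1) = 1 + cont x 4 (- 1) * cont x 6 (- 2)"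
    by (simp add: cont_expand) algebra
  ultimately have "z (- 2) * (cont x 5 (- 2) * y 1) = z (- 2) * (cont x 4 (- 1) * z (- 1) + z (- 3))"
    using z_y' zz[of "- 2"] zz[of "- 3"] by simp algebra
  then show ?thesis using nz(5) by simp
qed

text \<open>One \<open>J\<close> is expressed over a chain of denominators, each formula following
  from an earlier one by an identity between neighbouring entries and cancellation. The way through
  \<open>J_x6\<close> to \<open>J_y2'\<close> crosses the centre and serves periodicity;
  \<open>J_x4\<close> leads back towards the leaf of \<open>x\<close>.\<close>

context
  fixes J
  assumes J: "z (- 2) * J = cont x 3 1 + cont x 3 (- 3)"
begin

lemma J_x5: "J * cont x 5 (- 2) = cont x 2 1 * z (- 1) + cont x 2 (- 2) * z (- 3)"
proof -
  have "cont x 5 (- 2) * cont x 3 1 = cont x 6 (- 2) * cont x 2 1 + cont x 2 (- 2)"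
    "cont x 5 (- 2) * cont x 3 (- 3) = cont x 6 (- 3) * cont x 2 (- 2) + cont x 2 1"
    using cont_euler[of x 2 2 "- 2" 0] cont_euler[of x 2 0 "- 3" 2] by (simp_all add: mult.commute)
  then have "z (- 2) * (J * cont x 5 (- 2)) = z (- 2) * (cont x 2 1 * z (- 1) + cont x 2 (- 2) * z (- 3))"
    using J zz[of "- 2"] zz[of "- 3"] by simp algebra
  then show ?thesis using nz(5) by simp
qed

lemma J_x6: "J * cont x 6 (- 2) = cont x 3 1 * z (- 1) + cont y 2 (- 2) * cont x 2 (- 2)"
proof -
  have "cont x 6 (- 2) * cont x 2 1 = cont x 5 (- 2) * cont x 3 1 - cont x 2 (- 2)"
    using cont_euler[of x 2 2 "- 2" 0] by simp
  then have "cont x 5 (- 2) * (J * cont x 6 (- 2))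
      = cont x 5 (- 2) * (cont x 3 1 * z (- 1) + cont y 2 (- 2) * cont x 2 (- 2))"
    using J_x5 x6_z' by algebra
  then show ?thesis using nz(2) by simp
qed

lemma J_y2: "J * cont y 2 (- 1) = cont x 4 1 + y (- 1) * cont x 2 (- 2)"
proof -
  have "cont y 2 (- 2) * cont y 2 (- 1) = 1 + y (- 1) * cont y 3 (- 2)"
    by (simp add: cont_expand) algebra
  moreover have "cont x 6 (- 2) * cont x 4 1 = cont x 7 (- 2) * cont x 3 1 + cont x 2 (- 2)"
    using cont_euler[of x 3 2 "- 2" 0] by simp
  ultimately have "cont x 6 (- 2) * (J * cont y 2 (- 1)) = cont x 6 (- 2) * (cont x 4 1 + y (- 1) * cont x 2 (- 2))"
    using J_x6 center[of "- 2"] x7[of "- 2"] by simp algebra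
  then show ?thesis using nz(3) by simp
qed

lemma J_x6': "J * cont x 6 (- 1) = y 1 * cont x 4 1 + z (- 1) * y (- 1) * x (- 1)"
proof -
  have "cont y 2 (- 1) * y 1 = cont y 3 (- 1) + y (- 1)"
    by (simp add: cont_expand)
  moreover have "cont x 6 (- 1) * cont x 2 (- 2) = cont x 4 1 + cont x 7 (- 2) * x (- 1)"
    using cont_euler[of x 1 0 "- 2" 4] by (simp add: cont_expand(1) mult.commute)
  ultimately have "cont y 2 (- 1) * (J * cont x 6 (- 1)) = cont y 2 (- 1) * (y 1 * cont x 4 1 + z (- 1) * y (- 1) * x (- 1))"
    using J_y2 center[of "- 1"] x7[of "- 2"] by simp algebra
  then show ?thesis using nz(4) by simp
qed

lemma J_y2': "J * cont y 2 0 = y 1 * y 3 + z (- 1) * x (- 1)"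
proof -
  have "cont x 7 (- 1) * cont x 4 1 = cont x 6 (- 1) * cont x 5 1 - x (- 1)"
    using cont_euler[of x 4 1 "- 1" 0] by simp
  then have "z 0 * (cont x 6 (- 1) * y 3) = z 0 * (cont y 2 0 * cont x 4 1 + z (- 1) * x (- 1))"
    using z_y x7[of "- 1"] zz[of "- 1"] by simp algebra
  then have "cont x 6 (- 1) * y 3 = cont y 2 0 * cont x 4 1 + z (- 1) * x (- 1)"
    using nz(5) by simp
  moreover have "cont y 2 0 * y (- 1) = cont y 3 (- 1) + y 1"
    by (simp add: cont_expand) algebra
  ultimately have "cont x 6 (- 1) * (J * cont y 2 0) = cont x 6 (- 1) * (y 1 * y 3 + z (- 1) * x (- 1))"
    using J_x6' center[of "- 1"] by algebra
  then show ?thesis using nz(3) by simp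
qed

lemma J_x4: "J * cont x 4 (- 1) = y 1 * cont x 2 1 + x (- 1) * z (- 3)"
proof -
  have "cont x 4 (- 1) * cont x 2 (- 2) = cont x 5 (- 2) * x (- 1) + cont x 2 1"
    by (simp add: cont_expand) algebra
  then have "cont x 5 (- 2) * (J * cont x 4 (- 1)) = cont x 5 (- 2) * (y 1 * cont x 2 1 + x (- 1) * z (- 3))"
    using J_x5 x5_y by algebra
  then show ?thesis using nz(2) by simp
qed

end

text \<open>Time reversal fixes \<open>z (- 2)\<close> and exchanges the two continuants in the
  numerator. Every formula for \<open>J\<close> therefore has a reflected one with the same
  \<open>J\<close>.\<close>

lemma mirror_J:
  assumes "z (- 2) * J = cont x 3 1 + cont x 3 (- 3)"
  shows "z (- 4 - (- 2)) * J = cont (\<lambda>i. x (0 - i)) 3 1 + cont (\<lambda>i. x (0 - i)) 3 (- 3)"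
  using assms unfolding cont_mirror by simp

lemmas x5_y' = e8_frieze.x5_y[OF mirror, simplified cont_mirror, simplified]

lemma x_y2: "x (- 4) * cont y 2 (- 2) = z (- 3) * y (- 2) + z (- 1)"
proof -
  have "x (- 4) * cont x 6 (- 3) = cont x 7 (- 4) + cont x 5 (- 2)"
    using cont_left[of x 5 "- 4"] by simp
  moreover have "cont y 2 (- 2) * cont y 2 (- 3) = 1 + y (- 2) * cont y 3 (- 3)"
    by (simp add: cont_expand) algebra
  ultimately have "cont x 6 (- 3) * (x (- 4) * cont y 2 (- 2)) = cont x 6 (- 3) * (z (- 3) * y (- 2) + z (- 1))"
    using zz[of "- 3"] x7[of "- 4"] x6_z_mirror center[of "- 3"] by simp algebra
  then show ?thesis using nz(3) by simp
qed

lemma y_x: "y (- 2) * x 4 = z (- 1) + x (- 4)"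
proof -
  have "x 4 * cont x 6 (- 2) = cont x 7 (- 2) + cont x 5 (- 2)"
    by (simp add: cont_expand)
  moreover have "y (- 2) * cont y 2 (- 1) = cont y 3 (- 2) + y 0"
    by (simp add: cont_expand) algebra
  moreover have "z (- 3) * y 0 = cont x 5 (- 2) + x (- 4)"
    using e8_frieze.z_y[OF shift[of "- 3"], simplified cont_shift, simplified] .
  moreover have "cont y 3 (- 2) = cont y 2 (- 2) * y 0 - y (- 2)"
    by (simp add: cont_expand)
  ultimately have "cont x 6 (- 2) * (y (- 2) * x 4) = cont x 6 (- 2) * (z (- 1) + x (- 4))"
    using x_y2 x7[of "- 2"] center[of "- 2"] by simp algebra
  then show ?thesis using nz(3) by simp
qed

text \<open>The descent along the arm of \<open>x\<close> continues through
  \<open>cont x 3 (- 1)\<close> and \<open>cont x 2 (- 1)\<close> until no denominator is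
  left.\<close>

lemma J_x1:
  assumes J: "z (- 2) * J = cont x 3 1 + cont x 3 (- 3)"
  shows "J * cont x 2 (- 1) = y 1 + x (- 1) * x (- 6)" and "J = x 1 * x (- 6) - y (- 4)"
proof -
  have x3: "J * cont x 3 (- 1) = x 1 * y 1 + x (- 1) * y (- 4)"
  proof -
    have "cont x 4 (- 1) * x 1 + x (- 1) = cont x 3 (- 1) * cont x 2 1"
      "cont x 4 (- 2) * x (- 1) + x 1 = cont x 3 (- 1) * cont x 2 (- 2)"
      by (simp add: cont_expand; algebra)+
    then have "cont x 5 (- 2) * (J * cont x 3 (- 1)) = cont x 5 (- 2) * (x 1 * y 1 + x (- 1) * y (- 4))"
      using J_x5[OF J] x5_y x5_y' by algebra
    then show ?thesis using nz(2) by simp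
  qed
  have s: "y (- 4) * x 2 = z (- 3) + x (- 6)"
    using e8_frieze.y_x[OF shift[of "- 2"]] by simp
  show x2: "J * cont x 2 (- 1) = y 1 + x (- 1) * x (- 6)"
  proof -
    have "cont x 2 (- 1) = cont x 3 (- 1) * x 2 - cont x 4 (- 1)" "cont x 2 1 = x 1 * x 2 - 1"
      by (simp_all add: cont_expand)
    then show ?thesis using x3 J_x4[OF J] s by algebra
  qed
  have "cont x 3 (- 1) = x 1 * cont x 2 (- 1) - x (- 1)" by (simp add: cont_expand)
  then have "x (- 1) * J = x (- 1) * (x 1 * x (- 6) - y (- 4))"
    using x2 x3 by algebra
  then show "J = x 1 * x (- 6) - y (- 4)" using nz(1) by simp
qed

text \<open>The reflected polynomial formula \<open>J = x (- 1) * x 6 - y 1\<close> cancels the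
  \<open>y 1\<close> in the formula over \<open>cont x 2 (- 1)\<close>.\<close>

lemma leaf_relation:
  assumes J: "z (- 2) * J = cont x 3 1 + cont x 3 (- 3)"
  shows "J * x 0 = x 6 + x (- 6)"
proof -
  have "J = x (- 1) * x 6 - y 1"
    using e8_frieze.J_x1(2)[OF mirror mirror_J[OF J]] by simp
  moreover have "cont x 2 (- 1) = x (- 1) * x 0 - 1" by (simp add: cont_expand)
  ultimately have "x (- 1) * (J * x 0) = x (- 1) * (x 6 + x (- 6))"
    using J_x1(1)[OF J] by algebra
  then show ?thesis using nz(1) by simp
qed

text \<open>\<open>J\<close> and \<open>J'\<close> belong to times 0 and 5. The formula
  \<open>J_y2'\<close> for \<open>J\<close> and its reflection for \<open>J'\<close> have the
  adjacent denominators \<open>cont y 2 0\<close> and \<open>cont y 2 1\<close>.\<close>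

lemma periodic:
  assumes J: "z (- 2) * J = cont x 3 1 + cont x 3 (- 3)"
    and J': "z 3 * J' = cont x 3 6 + cont x 3 2"
  shows "J = J'"
proof -
  have 1: "J * cont y 2 0 = y 1 * y 3 + z (- 1) * x (- 1)" using J_y2'[OF J] .
  have 2: "J' * cont y 2 1 = y 1 * y (- 1) + z 2 * x 6"
    using e8_frieze.J_y2'[OF e8_frieze.mirror[OF shift[of 5]] e8_frieze.mirror_J[OF shift[of 5]], of J'] J'
    by (simp add: cont_mirror cont_shift)
  have e: "x (- 1) * cont x 7 0 = cont x 8 (- 1) + cont x 6 1"
    using cont_left[of x 6 "- 1"] by simp
  have e': "x 6 * cont x 7 (- 1) = cont x 8 (- 1) + cont x 6 (- 1)"
    using cont_expand(7)[of x "- 1"] by simp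
  have e8: "cont x 6 0 * cont x 8 (- 1) = cont x 7 (- 1) * cont x 7 0 - 1"
    using cont_euler[of x 6 0 "- 1" 0] by (simp add: mult.commute)
  have c: "cont y 2 0 * cont y 2 1 = 1 + y 1 * cont y 3 0"
    "cont y 2 0 * y (- 1) = cont y 3 (- 1) + y 1" "cont y 2 1 * y 3 = cont y 3 1 + y 1"
    by (simp add: cont_expand; algebra)+
  \<comment> \<open>With this value of \<open>cont x 8 (- 1)\<close>, the expressions obtained
    below, which differ by exchanging \<open>cont x 6 (- 1)\<close> and \<open>cont x 6 1\<close>,
    become symmetric in these two.\<close>
  have "cont x 6 0 * (cont x 8 (- 1)) = cont x 6 0 * (y 1 * z 0 * z 1 + 1)"
    using e8 c(1) x7[of "-1"] x7[of 0] zz[of 0] center[of 0] by simp algebra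
  then have x8: "cont x 8 (- 1) = y 1 * z 0 * z 1 + 1" using nz(3) by simp
  have "z 0 * z 1 * (cont y 2 0 * cont y 2 1 * J) = z 0 * z 1 * (cont y 2 0 * cont y 2 1 * J')"
  proof -
    have a: "z 0 * z 1 * (cont y 2 1 * z (- 1) * x (- 1)) = (1 + cont x 6 (- 1)) * (cont x 8 (- 1) + cont x 6 1)"
      using e x7[of 0] zz[of "- 1"] by simp algebra
    have b: "z 0 * z 1 * (cont y 2 0 * z 2 * x 6) = (1 + cont x 6 1) * (cont x 8 (- 1) + cont x 6 (- 1))"
      using e' x7[of "- 1"] zz[of 1] by simp algebra
    have "z 0 * z 1 * (cont y 2 0 * cont y 2 1 * J)
        = z 0 * z 1 * y 1 * (cont x 6 1 + y 1) + (1 + cont x 6 (- 1)) * (cont x 8 (- 1) + cont x 6 1)"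
      using 1 a c(3) center[of 1] by algebra
    moreover have "z 0 * z 1 * (cont y 2 0 * cont y 2 1 * J')
        = z 0 * z 1 * y 1 * (cont x 6 (- 1) + y 1) + (1 + cont x 6 1) * (cont x 8 (- 1) + cont x 6 (- 1))"
      using 2 b c(2) center[of "- 1"] by algebra
    ultimately show ?thesis unfolding x8 by (simp add: algebra_simps)
  qed
  then show ?thesis using nz by simp
qed

definition J :: "int \<Rightarrow> 'a" where
  "J n = (cont x 3 (n + 1) + cont x 3 (n - 3)) / z (n - 2)"

lemma J_z: "z (n - 2) * J n = cont x 3 (n + 1) + cont x 3 (n - 3)"
  by (simp add: J_def nz)

lemma leaf: "x (n + 6) + x (n - 6) = J n * x n"
  using e8_frieze.leaf_relation[OF shift[of n], of "J n"] J_z[of n]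
  by (simp add: cont_shift algebra_simps)

lemma J_periodic: "J (n + 5) = J n"
  using e8_frieze.periodic[OF shift[of n], of "J n" "J (n + 5)"] J_z[of n] J_z[of "n + 5"]
  by (simp add: cont_shift algebra_simps)

theorem trace: "(x (n + 60) + x n) * x (m + 30) = (x (m + 60) + x m) * x (n + 30)"
proof -
  \<comment> \<open>Six units of time are one unit modulo the period 5 of \<open>J\<close>.\<close>
  have step: "x (n + 6 * (i + 1)) + x (n + 6 * (i - 1)) = J (i + n) * x (n + 6 * i)" for n i
    using leaf[of "n + 6 * i"] periodic_mult[of J 5 "i + n" i, OF J_periodic] by (simp add: algebra_simps)
  have "(x (n + 6 * (2 * 5)) + x (n + 6 * 0)) * x (m + 6 * 5) = (x (m + 6 * (2 * 5)) + x (m + 6 * 0)) * x (n + 6 * 5)"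
    by (rule hill[of J 5 _ n _ m]) (simp_all only: step J_periodic nz not_False_eq_True)
  then show ?thesis by simp
qed

end

section \<open>From quivers to friezes\<close>

lemma rf_var_nonzero: "rf_var k \<noteq> 0"
proof
  assume "rf_var k = 0"
  then have "Poly_Mapping.lookup (Poly_Mapping.single (Poly_Mapping.single k (1::nat)) (1::complex)) (Poly_Mapping.single k 1) = 0"
    by (simp add: rf_var_def)
  then show False by (simp only: lookup_single_eq) simp
qed

text \<open>An injective additive map vanishes only at 0, so the shift carries nonvanishing from the
  initial variables to all times, in both directions.\<close>

lemma frieze_nonzero:
  assumes fr: "frieze_sequence Q X" and sh: "is_shift Q X \<phi>" and k: "k \<in> verts Q"
  shows "X k n \<noteq> 0"
proof -
  have inj: "inj \<phi>" and add: "\<phi> (f + g) = \<phi> f + \<phi> g" and X: "\<phi> (X k n) = X k (n + 1)" for f g n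
    using sh[unfolded is_shift_def] k by (blast dest: bij_is_inj)+
  have "\<phi> 0 + \<phi> 0 = \<phi> 0 + 0"
    unfolding add[symmetric] by simp
  then have "\<phi> 0 = 0" by (rule add_left_imp_eq)
  then have step: "X k (n + 1) = 0 \<longleftrightarrow> X k n = 0" for n
    using inj_eq[OF inj, of "X k n" 0] by (simp only: X)
  show ?thesis
  proof (induction n rule: int_induct[where k = 0])
    case base
    then show ?case using fr k by (simp add: frieze_sequence_def rf_var_nonzero)
  next
    case (step2 i)
    then show ?case using step[of "i - 1"] by simp
  qed (simp add: step)
qed

text \<open>\<open>K\<close> is read off at one vertex at time 0, and \<open>tr\<close> extends it
  to all of \<open>S\<close> and all times. Applying \<open>\<phi>\<close> to the defining equation
  gives the equation at time 1, which \<open>K\<close> satisfies as well.\<close>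

lemma invariant_trace:
  assumes sh: "is_shift Q X \<phi>" and S: "S \<subseteq> verts Q" "S \<noteq> {}"
    and nz: "\<And>k n. k \<in> S \<Longrightarrow> X k n \<noteq> 0"
    and tr: "\<And>k k' n m. k \<in> S \<Longrightarrow> k' \<in> S \<Longrightarrow>
      (X k (n + 2 * b) + X k n) * X k' (m + b) = (X k' (m + 2 * b) + X k' m) * X k (n + b)"
  shows "\<exists>K. \<phi> K = K \<and> (\<forall>k\<in>S. \<forall>n. X k (n + 2 * b) - K * X k (n + b) + X k n = 0)"
proof -
  obtain e where e: "e \<in> S" using S by blast
  define K where "K = (X e (2 * b) + X e 0) / X e b"
  have K: "K * X e b = X e (2 * b) + X e 0" using nz[OF e] by (simp add: K_def)
  have rel: "K * X k (n + b) = X k (n + 2 * b) + X k n" if k: "k \<in> S" for k n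
  proof -
    have "X e b * (K * X k (n + b)) = X e b * (X k (n + 2 * b) + X k n)"
      using tr[OF k e, of n 0] K by (simp add: mult.assoc[symmetric] mult.commute)
    then show ?thesis using nz[OF e] by simp
  qed
  have hom: "\<phi> (f * g) = \<phi> f * \<phi> g" "\<phi> (f + g) = \<phi> f + \<phi> g" "\<phi> (X e n) = X e (n + 1)" for f g n
    using sh[unfolded is_shift_def] e S(1) by blast+
  have "\<phi> K * X e (b + 1) = X e (2 * b + 1) + X e (0 + 1)"
    using arg_cong[OF K, of \<phi>] unfolding hom .
  also have "\<dots> = K * X e (b + 1)" using rel[OF e, of 1] by (simp only: add.commute[of _ b] add.commute[of _ "2 * b"] add_0)
  finally have "\<phi> K = K" using nz[OF e] by simp
  moreover have "X k (n + 2 * b) - K * X k (n + b) + X k n = 0" if "k \<in> S" for k n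
    unfolding rel[OF that] by simp
  ultimately show ?thesis by blast
qed

text \<open>
  The tree is rooted at \<open>r\<close>, with \<open>par m\<close> the parent and \<open>d m\<close> the depth of \<open>m\<close>; the shift \<open>h\<close> changes
  by one along the edges that do not point away from the root.
\<close>

lemma tree_frieze:
  fixes Q :: "('v::linorder, 'e) pre_digraph"
  assumes fr: "frieze_sequence Q X" and l: "bij_betw l V (verts Q)"
    and graph: "underlying_simple_graph E l Q" and E: "E = (\<lambda>m. {m, par m}) ` (V - {r})"
    and V: "finite V"
    and par: "\<And>m. m \<in> V - {r} \<Longrightarrow> par m \<in> V" "\<And>m. m \<in> V - {r} \<Longrightarrow> d m = Suc (d (par m))"
  obtains h :: "nat \<Rightarrow> int" where "\<And>m n. m \<in> V \<Longrightarrow>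
    X (l m) (n + 1 + h m) * X (l m) (n + h m) =
      1 + (if m = r then 1 else X (l (par m)) (n + h (par m)))
        * (\<Prod>j\<in>{j \<in> V - {r}. par j = m}. X (l j) (n + 1 + h j))"
proof -
  define f where "f j = {l j, l (par j)}" for j
  define g where "g a = {tail Q a, head Q a}" for a
  have linj: "l i = l j \<longleftrightarrow> i = j" if "i \<in> V" "j \<in> V" for i j
    using l that by (auto simp: bij_betw_def inj_on_def)
  have neq: "j \<noteq> par j" if "j \<in> V - {r}" for j
    using par(2)[OF that] by auto
  have f_inj: "inj_on f (V - {r})"
  proof (rule inj_onI)
    fix i j
    assume ij: "i \<in> V - {r}" "j \<in> V - {r}" and "f i = f j"
    then have "i = j \<or> i = par j \<and> j = par i"
      using par(1)[of i] par(1)[of j] linj by (auto simp: f_def doubleton_eq_iff)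
    then show "i = j" using par(2)[OF ij(1)] par(2)[OF ij(2)] by auto
  qed
  have "(\<lambda>e. l ` e) ` E = f ` (V - {r})"
    by (auto simp: E f_def image_image)
  then have g: "bij_betw g (arcs Q) (f ` (V - {r}))"
    using graph by (simp add: underlying_simple_graph_def g_def[abs_def])
  \<comment> \<open>\<open>A j\<close> is the arrow between \<open>j\<close> and its parent, so that
    arrows are indexed by the vertices other than the root.\<close>
  define A where "A = inv_into (arcs Q) g \<circ> f"
  have A: "bij_betw A (V - {r}) (arcs Q)"
    unfolding A_def by (rule bij_betw_trans[OF inj_on_imp_bij_betw[OF f_inj] bij_betw_inv_into[OF g]])
  have gA: "{tail Q (A j), head Q (A j)} = {l j, l (par j)}" if "j \<in> V - {r}" for j
  proof -
    have "f j \<in> g ` arcs Q" using g that by (auto simp: bij_betw_def)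
    then have "g (A j) = f j" by (simp add: A_def f_inv_into_f)
    then show ?thesis by (simp add: g_def f_def)
  qed
  define e :: "nat \<Rightarrow> int" where "e j = (if tail Q (A j) = l (par j) then 0 else 1)" for j
  have ends: "e j = 0 \<and> tail Q (A j) = l (par j) \<and> head Q (A j) = l j
      \<or> e j = 1 \<and> tail Q (A j) = l j \<and> head Q (A j) = l (par j)" if j: "j \<in> V - {r}" for j
    using gA[OF j] neq[OF j] linj[of j "par j"] par(1)[OF j] j
    by (auto simp: e_def doubleton_eq_iff)
  define h where "h m = - (\<Sum>i<d m. e ((par ^^ i) m))" for m
  have h: "h (par m) = h m + e m" if "m \<in> V - {r}" for m
    unfolding h_def par(2)[OF that] by (simp add: sum.lessThan_Suc_shift funpow_swap1 del: sum.lessThan_Suc)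
  show ?thesis
  proof (rule that)
    fix m n
    assume m: "m \<in> V"
    define N where "N = n + h m"
    have "l m \<in> verts Q" using m l by (auto simp: bij_betw_def)
    then have fr_m: "X (l m) (N + 1) * X (l m) N =
        1 + (\<Prod>a\<in>in_arcs Q (l m). X (tail Q a) N) * (\<Prod>a\<in>out_arcs Q (l m). X (head Q a) (N + 1))"
      using fr unfolding frieze_sequence_def by blast
    \<comment> \<open>The factor contributed to the mesh relation at \<open>m\<close> by the edge
      between \<open>j\<close> and its parent. The offset by \<open>e\<close> makes it independent
      of whether the arrow enters or leaves \<open>m\<close>.\<close>
    define G where "G j = (if j = m then X (l (par m)) (N + e m) else X (l j) (N + 1 - e j))" for j
    define I where "I = {j \<in> V - {r}. head Q (A j) = l m}"
    define O' where "O' = {j \<in> V - {r}. tail Q (A j) = l m}"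
    have arcs_A: "arcs Q = A ` (V - {r})" using A by (simp add: bij_betw_def)
    have in_out: "in_arcs Q (l m) = A ` I" "out_arcs Q (l m) = A ` O'"
      by (auto simp: in_arcs_def out_arcs_def I_def O'_def arcs_A)
    have injA: "inj_on A I" "inj_on A O'"
      using A by (auto simp: bij_betw_def I_def O'_def intro: inj_on_subset)
    have I: "j \<in> I \<longleftrightarrow> j \<in> V - {r} \<and> (e j = 0 \<and> j = m \<or> e j = 1 \<and> par j = m)"
      and O': "j \<in> O' \<longleftrightarrow> j \<in> V - {r} \<and> (e j = 1 \<and> j = m \<or> e j = 0 \<and> par j = m)" for j
    proof -
      have "(head Q (A j) = l m \<longleftrightarrow> e j = 0 \<and> j = m \<or> e j = 1 \<and> par j = m)
          \<and> (tail Q (A j) = l m \<longleftrightarrow> e j = 1 \<and> j = m \<or> e j = 0 \<and> par j = m)" if j: "j \<in> V - {r}"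
      proof -
        have "l j = l m \<longleftrightarrow> j = m" "l (par j) = l m \<longleftrightarrow> par j = m"
          using linj par(1)[OF j] j m by auto
        then show ?thesis using ends[OF j] by (elim disjE conjE) simp_all
      qed
      then show "j \<in> I \<longleftrightarrow> j \<in> V - {r} \<and> (e j = 0 \<and> j = m \<or> e j = 1 \<and> par j = m)"
        "j \<in> O' \<longleftrightarrow> j \<in> V - {r} \<and> (e j = 1 \<and> j = m \<or> e j = 0 \<and> par j = m)"
        unfolding I_def O'_def mem_Collect_eq by blast+
    qed
    have G_I: "X (tail Q (A j)) N = G j" if "j \<in> I" for j
    proof -
      have j: "j \<in> V - {r}" and d: "e j = 0 \<and> j = m \<or> e j = 1 \<and> par j = m"
        using that unfolding I by auto
      show ?thesis using d ends[OF j] neq[OF j] unfolding G_def by (elim disjE conjE) simp_all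
    qed
    have G_O: "X (head Q (A j)) (N + 1) = G j" if "j \<in> O'" for j
    proof -
      have j: "j \<in> V - {r}" and d: "e j = 1 \<and> j = m \<or> e j = 0 \<and> par j = m"
        using that unfolding O' by auto
      show ?thesis using d ends[OF j] neq[OF j] unfolding G_def by (elim disjE conjE) simp_all
    qed
    have "j \<in> I \<union> O' \<longleftrightarrow> j \<in> {j \<in> V - {r}. j = m} \<union> {j \<in> V - {r}. par j = m}" for j
    proof -
      have "e j = 0 \<or> e j = 1" by (simp add: e_def)
      then show ?thesis unfolding Un_iff I O' mem_Collect_eq by blast
    qed
    then have un: "I \<union> O' = {j \<in> V - {r}. j = m} \<union> {j \<in> V - {r}. par j = m}" by blast
    have dis: "I \<inter> O' = {}"
    proof -
      have "j \<notin> O'" if "j \<in> I" for j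
        using that neq[of j] unfolding I O' by force
      then show ?thesis by blast
    qed
    have "(\<Prod>a\<in>in_arcs Q (l m). X (tail Q a) N) * (\<Prod>a\<in>out_arcs Q (l m). X (head Q a) (N + 1))
        = (\<Prod>j\<in>I. G j) * (\<Prod>j\<in>O'. G j)"
      unfolding in_out using injA G_I G_O by (simp add: prod.reindex cong: prod.cong)
    also have "\<dots> = (\<Prod>j\<in>I \<union> O'. G j)"
      using dis V by (subst prod.union_disjoint) (auto simp: I_def O'_def)
    also have "\<dots> = (\<Prod>j\<in>{j \<in> V - {r}. j = m}. G j) * (\<Prod>j\<in>{j \<in> V - {r}. par j = m}. G j)"
      unfolding un using V neq[of m] by (intro prod.union_disjoint) auto
    also have "(\<Prod>j\<in>{j \<in> V - {r}. j = m}. G j) = (if m = r then 1 else X (l (par m)) (n + h (par m)))"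
    proof (cases "m = r")
      case False
      then have "{j \<in> V - {r}. j = m} = {m}" using m by auto
      then show ?thesis using False m h[of m] by (simp add: G_def N_def add.assoc)
    qed (auto simp: prod.neutral)
    also have "(\<Prod>j\<in>{j \<in> V - {r}. par j = m}. G j) = (\<Prod>j\<in>{j \<in> V - {r}. par j = m}. X (l j) (n + 1 + h j))"
    proof (rule prod.cong[OF refl])
      fix j
      assume j: "j \<in> {j \<in> V - {r}. par j = m}"
      then have "h m = h j + e j" using h[of j] by auto
      then show "G j = X (l j) (n + 1 + h j)"
        using j neq[of j] by (auto simp: G_def N_def algebra_simps)
    qed
    finally have "X (l m) (N + 1) * X (l m) N = 1 + (if m = r then 1 else X (l (par m)) (n + h (par m)))
        * (\<Prod>j\<in>{j \<in> V - {r}. par j = m}. X (l j) (n + 1 + h j))"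
      using fr_m by (simp only:)
    moreover have "n + 1 + h m = N + 1" by (simp add: N_def)
    ultimately show "X (l m) (n + 1 + h m) * X (l m) (n + h m) =
      1 + (if m = r then 1 else X (l (par m)) (n + h (par m)))
        * (\<Prod>j\<in>{j \<in> V - {r}. par j = m}. X (l j) (n + 1 + h j))"
      by (simp only: N_def)
  qed
qed

text \<open>
  The cycle is unrolled to a line, along which \<open>h\<close> grows by one at each of the \<open>p\<close> arrows in the
  direction of increasing labels: going round once shifts the time by \<open>p\<close>.
\<close>

lemma cycle_frieze:
  fixes Q :: "('v::linorder, 'e) pre_digraph"
  assumes fr: "frieze_sequence Q X" and l: "bij_betw l {1..p + q} (verts Q)"
    and cyc: "oriented_cycle p q l Q" and pq: "1 \<le> p" "1 \<le> q"
    and nz: "\<And>k n. k \<in> verts Q \<Longrightarrow> X k n \<noteq> 0"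
  obtains h :: "int \<Rightarrow> int" where
    "a_frieze (int p) (int q) (\<lambda>t n. X (l (nat (t mod int (p + q)) + 1)) (n + h t))"
proof -
  obtain e C D where e: "bij_betw e {1..p + q} (arcs Q)"
    and CD: "C \<union> D = {1..p + q}" "C \<inter> D = {}" and card: "card C = p"
    and C: "\<And>i. i \<in> C \<Longrightarrow> tail Q (e i) = l i \<and> head Q (e i) = l (i mod (p + q) + 1)"
    and D: "\<And>i. i \<in> D \<Longrightarrow> tail Q (e i) = l (i mod (p + q) + 1) \<and> head Q (e i) = l i"
    using cyc unfolding oriented_cycle_def by blast
  define P where "P = p + q"
  have P: "2 \<le> P" using pq by (simp add: P_def)
  define lab where "lab t = nat (t mod int P) + 1" for t
  have lab: "lab t \<in> {1..P}" for t
  proof -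
    have "0 \<le> t mod int P" "t mod int P < int P" using P by simp_all
    then show ?thesis by (simp add: lab_def nat_less_iff Suc_le_eq)
  qed
  have lab_per: "lab (t + int P) = lab t" for t by (simp add: lab_def)
  have lab_suc: "lab (t + 1) = lab t mod P + 1" for t
  proof -
    have "int (nat (t mod int P) + 1) mod int P = (t + 1) mod int P"
      using P by (simp add: mod_simps add.commute)
    then have "nat ((t + 1) mod int P) = (nat (t mod int P) + 1) mod P"
      by (metis nat_int zmod_int)
    then show ?thesis by (simp add: lab_def)
  qed
  have suc_inj: "i = j" if "i mod P + 1 = j mod P + 1" "i \<in> {1..P}" "j \<in> {1..P}" for i j
    using that by (cases "i = P"; cases "j = P") auto
  have suc_neq: "i mod P + 1 \<noteq> i" if "i \<in> {1..P}" for i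
    using that P by (cases "i = P") auto
  have linj: "l i = l j \<longleftrightarrow> i = j" if "i \<in> {1..P}" "j \<in> {1..P}" for i j
    using l that inj_on_eq_iff[of l "{1..P}" i j] unfolding bij_betw_def P_def by blast
  define \<sigma> :: "nat \<Rightarrow> int" where "\<sigma> i = (if i \<in> C then 1 else 0)" for i
  \<comment> \<open>The second sum continues \<open>h\<close> to negative positions, so that its
    increment is \<open>\<sigma>\<close> everywhere.\<close>
  define h :: "int \<Rightarrow> int" where "h t = (\<Sum>i\<in>{0..<t}. \<sigma> (lab i)) - (\<Sum>i\<in>{t..<0}. \<sigma> (lab i))" for t
  have h: "h (t + 1) = h t + \<sigma> (lab t)" for t
  proof (cases "0 \<le> t")
    case True
    then have "{0..<t + 1} = insert t {0..<t}" "{t..<0} = {}" "{t + 1..<0} = {}" by auto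
    then show ?thesis by (simp add: h_def)
  next
    case False
    then have "{t..<0} = insert t {t + 1..<0}" "{0..<t} = {}" "{0..<t + 1} = {}" by auto
    then show ?thesis by (simp add: h_def)
  qed
  have "h (int k) = (\<Sum>i<k. \<sigma> (lab (int i)))" for k
  proof (induction k)
    case (Suc k)
    then show ?case using h[of "int k"] by (simp add: add.commute)
  qed (simp add: h_def)
  then have "h (int P) = (\<Sum>i<P. \<sigma> (i + 1))"
    by (simp add: lab_def nat_mod_distrib)
  also have "\<dots> = (\<Sum>i\<in>{1..P}. \<sigma> i)"
    by (rule sum.reindex_bij_witness[of _ "\<lambda>i. i - 1" "\<lambda>i. i + 1"]) auto
  also have "\<dots> = int (card ({1..P} \<inter> C))"
    by (simp add: \<sigma>_def sum.If_cases)
  also have "{1..P} \<inter> C = C" using CD(1) unfolding P_def by blast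
  finally have hP: "h (int P) = int p" by (simp add: card)
  have h_per: "h (t + int P) = h t + int p" for t
  proof -
    have "h (t + 1 + int P) - h (t + 1) = h (t + int P) - h t" for t
      using h[of "t + int P"] h[of t] by (simp add: lab_per algebra_simps)
    then have "h (0 + 1 * t + int P) - h (0 + 1 * t) = h (0 + int P) - h 0"
      using periodic_mult[of "\<lambda>t. h (t + int P) - h t" 1 0 t] by simp
    then show ?thesis using hP by (simp add: h_def)
  qed
  have key: "X (l m) (N + 1) * X (l m) N =
      1 + X (l i0) (N + 1 - \<sigma> i0) * X (l (m mod P + 1)) (N + \<sigma> m)"
    if m: "m \<in> {1..P}" and i0: "i0 \<in> {1..P}" "i0 mod P + 1 = m" for m i0 N
  proof -
    have "l m \<in> verts Q" using m l by (auto simp: bij_betw_def P_def)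
    then have fr_m: "X (l m) (N + 1) * X (l m) N =
        1 + (\<Prod>a\<in>in_arcs Q (l m). X (tail Q a) N) * (\<Prod>a\<in>out_arcs Q (l m). X (head Q a) (N + 1))"
      using fr unfolding frieze_sequence_def by blast
    \<comment> \<open>Factors are indexed by the edges \<open>i0\<close> and \<open>m\<close>, not
      by neighbouring vertices: for \<open>p = q = 1\<close> both neighbours are the same
      vertex.\<close>
    define G where "G i = (if i = m then X (l (m mod P + 1)) (N + \<sigma> m) else X (l i0) (N + 1 - \<sigma> i0))" for i
    define I where "I = {i \<in> {1..P}. i \<in> C \<and> i = i0 \<or> i \<in> D \<and> i = m}"
    define O' where "O' = {i \<in> {1..P}. i \<in> C \<and> i = m \<or> i \<in> D \<and> i = i0}"
    have neq: "i0 \<noteq> m" using suc_neq[OF i0(1)] i0(2) by auto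
    have arcs: "arcs Q = e ` {1..P}" using e by (simp add: bij_betw_def P_def)
    have suc: "i mod P + 1 \<in> {1..P}" for i using P by (simp add: Suc_le_eq)
    have suc_m: "l (i mod P + 1) = l m \<longleftrightarrow> i = i0" if "i \<in> {1..P}" for i
      using linj[OF suc m] suc_inj[OF _ that i0(1)] i0(2) by auto
    have mem: "i \<in> C \<and> i \<notin> D \<or> i \<notin> C \<and> i \<in> D" if "i \<in> {1..P}" for i
      using CD that unfolding P_def by blast
    have hd: "head Q (e i) = l m \<longleftrightarrow> i \<in> C \<and> i = i0 \<or> i \<in> D \<and> i = m"
      and tl: "tail Q (e i) = l m \<longleftrightarrow> i \<in> C \<and> i = m \<or> i \<in> D \<and> i = i0" if i: "i \<in> {1..P}" for i
      using mem[OF i] C[of i] D[of i] suc_m[OF i] linj[OF i m] unfolding P_def by auto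
    have in_out: "in_arcs Q (l m) = e ` I" "out_arcs Q (l m) = e ` O'"
      unfolding in_arcs_def out_arcs_def I_def O'_def arcs using hd tl by auto
    have inj: "inj_on e I" "inj_on e O'"
      using e by (auto simp: bij_betw_def I_def O'_def P_def intro: inj_on_subset)
    have G_I: "X (tail Q (e i)) N = G i" if "i \<in> I" for i
    proof -
      have "i \<in> C \<and> i = i0 \<or> i \<in> D \<and> i \<notin> C \<and> i = m" using that CD by (auto simp: I_def)
      then show ?thesis using C[of i] D[of i] neq by (auto simp: G_def \<sigma>_def P_def)
    qed
    have G_O: "X (head Q (e i)) (N + 1) = G i" if "i \<in> O'" for i
    proof -
      have "i \<in> C \<and> i = m \<or> i \<in> D \<and> i \<notin> C \<and> i = i0" using that CD by (auto simp: O'_def)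
      then show ?thesis using C[of i] D[of i] neq by (auto simp: G_def \<sigma>_def P_def)
    qed
    have un: "I \<union> O' = {m, i0}" and dis: "I \<inter> O' = {}"
      using mem[OF m] mem[OF i0(1)] m i0(1) neq by (auto simp: I_def O'_def)
    have fin: "finite I" "finite O'" by (simp_all add: I_def O'_def)
    have "(\<Prod>a\<in>in_arcs Q (l m). X (tail Q a) N) * (\<Prod>a\<in>out_arcs Q (l m). X (head Q a) (N + 1))
        = (\<Prod>i\<in>I. G i) * (\<Prod>i\<in>O'. G i)"
      unfolding in_out using inj G_I G_O by (simp add: prod.reindex cong: prod.cong)
    also have "\<dots> = (\<Prod>i\<in>{m, i0}. G i)"
      unfolding un[symmetric] by (rule prod.union_disjoint[OF fin dis, symmetric])
    also have "\<dots> = X (l i0) (N + 1 - \<sigma> i0) * X (l (m mod P + 1)) (N + \<sigma> m)"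
      using neq by (simp add: G_def)
    finally show ?thesis using fr_m by (simp only:)
  qed
  have "a_frieze (int p) (int q) (\<lambda>t n. X (l (lab t)) (n + h t))"
  proof
    fix t n
    have "X (l (lab t)) (n + h t + 1) * X (l (lab t)) (n + h t) =
        1 + X (l (lab (t - 1))) (n + h t + 1 - \<sigma> (lab (t - 1))) * X (l (lab (t + 1))) (n + h t + \<sigma> (lab t))"
      using key[OF lab lab, of "t - 1" t "n + h t"] lab_suc[of "t - 1"] lab_suc[of t] by simp
    moreover have "n + h t + 1 - \<sigma> (lab (t - 1)) = n + 1 + h (t - 1)" "n + h t + \<sigma> (lab t) = n + h (t + 1)"
      "n + h t + 1 = n + 1 + h t"
      using h[of "t - 1"] h[of t] by simp_all
    ultimately show "X (l (lab t)) (n + 1 + h t) * X (l (lab t)) (n + h t) =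
        1 + X (l (lab (t - 1))) (n + 1 + h (t - 1)) * X (l (lab (t + 1))) (n + h (t + 1))"
      by (simp only:)
  next
    fix t n
    show "X (l (lab (t + int p + int q))) (n + h (t + int p + int q)) = X (l (lab t)) (n + int p + h t)"
      using lab_per[of t] h_per[of t] by (simp add: P_def algebra_simps)
  next
    fix t n
    show "X (l (lab t)) (n + h t) \<noteq> 0"
      using bij_betwE[OF l] nz lab[of t] unfolding P_def by blast
  qed
  then show ?thesis by (intro that) (simp add: lab_def P_def)
qed

text \<open>The vertices carry different shifts \<open>h\<close>; these disappear because the times
  \<open>n\<close> and \<open>m\<close> in the relation are independent.\<close>

lemma trace_transfer:
  assumes "\<And>i j n m. i \<in> S \<Longrightarrow> j \<in> S \<Longrightarrow>
      (Y i (n + 2 * b) + Y i n) * Y j (m + b) = (Y j (m + 2 * b) + Y j m) * Y i (n + b)"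
    and Y: "\<And>i n. Y i n = X (l i) (n + h i)" and "k \<in> l ` S" "k' \<in> l ` S"
  shows "(X k (n + 2 * b) + X k n) * X k' (m + b) = (X k' (m + 2 * b) + X k' m) * X k (n + b :: int)"
proof -
  obtain i j where "i \<in> S" "k = l i" "j \<in> S" "k' = l j" using assms(3,4) by blast
  then show ?thesis
    using assms(1)[of i j "n - h i" "m - h j"] by (simp add: Y algebra_simps)
qed

section \<open>Trace relations for quivers of each type\<close>

lemma E6_tilde_trace:
  assumes fr: "frieze_sequence Q X" and l: "bij_betw l {1..7} (verts Q)"
    and graph: "underlying_simple_graph E6_tilde_edges l Q"
    and nz: "\<And>k n. k \<in> verts Q \<Longrightarrow> X k n \<noteq> 0"
    and k: "k \<in> l ` {3, 5, 7}" "k' \<in> l ` {3, 5, 7}"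
  shows "(X k (n + 2 * 6) + X k n) * X k' (m + 6) = (X k' (m + 2 * 6) + X k' m) * X k (n + 6)"
proof -
  define par :: "nat \<Rightarrow> nat" where "par = (\<lambda>m. if m \<in> {2, 4, 6} then 1 else m - 1)"
  \<comment> \<open>Labels start at 1, so entry 0 of the list is a placeholder.\<close>
  define d :: "nat \<Rightarrow> nat" where "d m = ([0, 0, 1, 2, 1, 2, 1, 2] ! m)" for m
  have V: "{1..7::nat} = {1, 2, 3, 4, 5, 6, 7}" by auto
  obtain h where H: "\<And>m n. m \<in> {1..7} \<Longrightarrow>
    X (l m) (n + 1 + h m) * X (l m) (n + h m) =
      1 + (if m = 1 then 1 else X (l (par m)) (n + h (par m)))
        * (\<Prod>j\<in>{j \<in> {1..7} - {1}. par j = m}. X (l j) (n + 1 + h j))"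
  proof (rule tree_frieze[OF fr l graph, of par 1 d])
    show "E6_tilde_edges = (\<lambda>m. {m, par m}) ` ({1..7} - {1})"
      unfolding V by (simp add: E6_tilde_edges_def par_def insert_commute)
  next
    fix m :: nat
    assume "m \<in> {1..7} - {1}"
    then have "m \<in> {2, 3, 4, 5, 6, 7}" unfolding V by auto
    then show "par m \<in> {1..7}" "d m = Suc (d (par m))"
      by (auto simp: par_def d_def)
  qed (simp, rule that)
  define Y where "Y m n = X (l m) (n + h m)" for m n
  have Y_nz: "Y m n \<noteq> 0" if "m \<in> {1..7}" for m n
    using bij_betwE[OF l] nz that unfolding Y_def by blast
  have children:
    "{j \<in> {1..7} - {1}. par j = 1} = {2, 4, 6}"
    "{j \<in> {1..7} - {1}. par j = 2} = {3}"
    "{j \<in> {1..7} - {1}. par j = 3} = {}"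
    "{j \<in> {1..7} - {1}. par j = 4} = {5}"
    "{j \<in> {1..7} - {1}. par j = 5} = {}"
    "{j \<in> {1..7} - {1}. par j = 6} = {7}"
    "{j \<in> {1..7} - {1}. par j = 7} = {}"
    unfolding V by (auto simp: par_def)
  have mesh: "Y m (n + 1) * Y m n = 1 + (if m = 1 then 1 else Y (par m) n)
      * (\<Prod>j\<in>{j \<in> {1..7} - {1}. par j = m}. Y j (n + 1))" if "m \<in> {1..7}" for m n
    using H[OF that] by (simp add: Y_def)
  \<comment> \<open>Listed from the leaf to the centre, in the form required by
    \<open>cont_step\<close>: the factor \<open>1\<close> is the continuant of length 0, and at the
    centre the other two arms are grouped into one factor.\<close>
  have x_mesh:
    "Y 3 (n + 1) * Y 3 n = 1 + 1 * Y 2 n"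
    "Y 2 (n + 1) * Y 2 n = 1 + Y 3 (n + 1) * Y 1 n"
    "Y 1 (n + 1) * Y 1 n = 1 + Y 2 (n + 1) * (Y 4 (n + 1) * Y 6 (n + 1))"
    for n
    using mesh[of 3 n] mesh[of 2 n] mesh[of 1 n] unfolding children
    by (simp_all add: par_def mult_ac)
  note x1 = cont_0_1[of "Y 3"]
  have x2: "cont (Y 3) 2 = Y 2"
    by (rule cont_step[OF x1 x_mesh(1)]) (simp_all add: Y_nz)
  have x3: "cont (Y 3) 3 = Y 1"
    by (rule cont_step[OF x1(2) x2 x_mesh(2)]) (simp_all add: Y_nz)
  have x4: "cont (Y 3) 4 = (\<lambda>n. (Y 4 (n + 1) * Y 6 (n + 1)))"
    by (rule cont_step[OF x2 x3 x_mesh(3)]) (simp_all add: Y_nz)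
  have y_mesh:
    "Y 5 (n + 1) * Y 5 n = 1 + 1 * Y 4 n"
    "Y 4 (n + 1) * Y 4 n = 1 + Y 5 (n + 1) * Y 1 n"
    "Y 1 (n + 1) * Y 1 n = 1 + Y 4 (n + 1) * (Y 6 (n + 1) * Y 2 (n + 1))"
    for n
    using mesh[of 5 n] mesh[of 4 n] mesh[of 1 n] unfolding children
    by (simp_all add: par_def mult_ac)
  note y1 = cont_0_1[of "Y 5"]
  have y2: "cont (Y 5) 2 = Y 4"
    by (rule cont_step[OF y1 y_mesh(1)]) (simp_all add: Y_nz)
  have y3: "cont (Y 5) 3 = Y 1"
    by (rule cont_step[OF y1(2) y2 y_mesh(2)]) (simp_all add: Y_nz)
  have y4: "cont (Y 5) 4 = (\<lambda>n. (Y 6 (n + 1) * Y 2 (n + 1)))"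
    by (rule cont_step[OF y2 y3 y_mesh(3)]) (simp_all add: Y_nz)
  have z_mesh:
    "Y 7 (n + 1) * Y 7 n = 1 + 1 * Y 6 n"
    "Y 6 (n + 1) * Y 6 n = 1 + Y 7 (n + 1) * Y 1 n"
    "Y 1 (n + 1) * Y 1 n = 1 + Y 6 (n + 1) * (Y 2 (n + 1) * Y 4 (n + 1))"
    for n
    using mesh[of 7 n] mesh[of 6 n] mesh[of 1 n] unfolding children
    by (simp_all add: par_def mult_ac)
  note z1 = cont_0_1[of "Y 7"]
  have z2: "cont (Y 7) 2 = Y 6"
    by (rule cont_step[OF z1 z_mesh(1)]) (simp_all add: Y_nz)
  have z3: "cont (Y 7) 3 = Y 1"
    by (rule cont_step[OF z1(2) z2 z_mesh(2)]) (simp_all add: Y_nz)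
  have z4: "cont (Y 7) 4 = (\<lambda>n. (Y 2 (n + 1) * Y 4 (n + 1)))"
    by (rule cont_step[OF z2 z3 z_mesh(3)]) (simp_all add: Y_nz)
  interpret e6_frieze "Y 3" "Y 5" "Y 7"
    by unfold_locales (simp_all add: x2 x3 x4 y2 y3 y4 z2 z3 z4 Y_nz)
  show ?thesis
  proof (rule trace_transfer[of "{3, 5, 7}" Y, OF _ Y_def k])
    have seq: "\<exists>s. Y i = leaf_seq s" if "i \<in> {3, 5, 7}" for i
    proof -
      have "Y 3 = leaf_seq 0" "Y 5 = leaf_seq 1" "Y 7 = leaf_seq 2"
        by (auto simp: leaf_seq_def)
      then show ?thesis using that by auto
    qed
    fix i j :: nat and n m
    assume "i \<in> {3, 5, 7}" "j \<in> {3, 5, 7}"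
    then obtain s t where "Y i = leaf_seq s" "Y j = leaf_seq t" using seq by meson
    then show "(Y i (n + 2 * 6) + Y i n) * Y j (m + 6) = (Y j (m + 2 * 6) + Y j m) * Y i (n + 6)"
      using trace[of s n t m] by simp
  qed
qed

lemma E7_tilde_trace:
  assumes fr: "frieze_sequence Q X" and l: "bij_betw l {1..8} (verts Q)"
    and graph: "underlying_simple_graph E7_tilde_edges l Q"
    and nz: "\<And>k n. k \<in> verts Q \<Longrightarrow> X k n \<noteq> 0"
    and k: "k \<in> l ` {4, 7}" "k' \<in> l ` {4, 7}"
  shows "(X k (n + 2 * 12) + X k n) * X k' (m + 12) = (X k' (m + 2 * 12) + X k' m) * X k (n + 12)"
proof -
  define par :: "nat \<Rightarrow> nat" where "par = (\<lambda>m. if m \<in> {2, 5, 8} then 1 else m - 1)"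
  define d :: "nat \<Rightarrow> nat" where "d m = ([0, 0, 1, 2, 3, 1, 2, 3, 1] ! m)" for m
  have V: "{1..8::nat} = {1, 2, 3, 4, 5, 6, 7, 8}" by auto
  obtain h where H: "\<And>m n. m \<in> {1..8} \<Longrightarrow>
    X (l m) (n + 1 + h m) * X (l m) (n + h m) =
      1 + (if m = 1 then 1 else X (l (par m)) (n + h (par m)))
        * (\<Prod>j\<in>{j \<in> {1..8} - {1}. par j = m}. X (l j) (n + 1 + h j))"
  proof (rule tree_frieze[OF fr l graph, of par 1 d])
    show "E7_tilde_edges = (\<lambda>m. {m, par m}) ` ({1..8} - {1})"
      unfolding V by (simp add: E7_tilde_edges_def par_def insert_commute)
  next
    fix m :: nat
    assume "m \<in> {1..8} - {1}"
    then have "m \<in> {2, 3, 4, 5, 6, 7, 8}" unfolding V by auto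
    then show "par m \<in> {1..8}" "d m = Suc (d (par m))"
      by (auto simp: par_def d_def)
  qed (simp, rule that)
  define Y where "Y m n = X (l m) (n + h m)" for m n
  have Y_nz: "Y m n \<noteq> 0" if "m \<in> {1..8}" for m n
    using bij_betwE[OF l] nz that unfolding Y_def by blast
  have children:
    "{j \<in> {1..8} - {1}. par j = 1} = {2, 5, 8}"
    "{j \<in> {1..8} - {1}. par j = 2} = {3}"
    "{j \<in> {1..8} - {1}. par j = 3} = {4}"
    "{j \<in> {1..8} - {1}. par j = 4} = {}"
    "{j \<in> {1..8} - {1}. par j = 5} = {6}"
    "{j \<in> {1..8} - {1}. par j = 6} = {7}"
    "{j \<in> {1..8} - {1}. par j = 7} = {}"
    "{j \<in> {1..8} - {1}. par j = 8} = {}"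
    unfolding V by (auto simp: par_def)
  have mesh: "Y m (n + 1) * Y m n = 1 + (if m = 1 then 1 else Y (par m) n)
      * (\<Prod>j\<in>{j \<in> {1..8} - {1}. par j = m}. Y j (n + 1))" if "m \<in> {1..8}" for m n
    using H[OF that] by (simp add: Y_def)
  have x_mesh:
    "Y 4 (n + 1) * Y 4 n = 1 + 1 * Y 3 n"
    "Y 3 (n + 1) * Y 3 n = 1 + Y 4 (n + 1) * Y 2 n"
    "Y 2 (n + 1) * Y 2 n = 1 + Y 3 (n + 1) * Y 1 n"
    "Y 1 (n + 1) * Y 1 n = 1 + Y 2 (n + 1) * (Y 5 (n + 1) * Y 8 (n + 1))"
    for n
    using mesh[of 4 n] mesh[of 3 n] mesh[of 2 n] mesh[of 1 n] unfolding children
    by (simp_all add: par_def mult_ac)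
  note x1 = cont_0_1[of "Y 4"]
  have x2: "cont (Y 4) 2 = Y 3"
    by (rule cont_step[OF x1 x_mesh(1)]) (simp_all add: Y_nz)
  have x3: "cont (Y 4) 3 = Y 2"
    by (rule cont_step[OF x1(2) x2 x_mesh(2)]) (simp_all add: Y_nz)
  have x4: "cont (Y 4) 4 = Y 1"
    by (rule cont_step[OF x2 x3 x_mesh(3)]) (simp_all add: Y_nz)
  have x5: "cont (Y 4) 5 = (\<lambda>n. (Y 5 (n + 1) * Y 8 (n + 1)))"
    by (rule cont_step[OF x3 x4 x_mesh(4)]) (simp_all add: Y_nz)
  have y_mesh:
    "Y 7 (n + 1) * Y 7 n = 1 + 1 * Y 6 n"
    "Y 6 (n + 1) * Y 6 n = 1 + Y 7 (n + 1) * Y 5 n"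
    "Y 5 (n + 1) * Y 5 n = 1 + Y 6 (n + 1) * Y 1 n"
    "Y 1 (n + 1) * Y 1 n = 1 + Y 5 (n + 1) * (Y 2 (n + 1) * Y 8 (n + 1))"
    for n
    using mesh[of 7 n] mesh[of 6 n] mesh[of 5 n] mesh[of 1 n] unfolding children
    by (simp_all add: par_def mult_ac)
  note y1 = cont_0_1[of "Y 7"]
  have y2: "cont (Y 7) 2 = Y 6"
    by (rule cont_step[OF y1 y_mesh(1)]) (simp_all add: Y_nz)
  have y3: "cont (Y 7) 3 = Y 5"
    by (rule cont_step[OF y1(2) y2 y_mesh(2)]) (simp_all add: Y_nz)
  have y4: "cont (Y 7) 4 = Y 1"
    by (rule cont_step[OF y2 y3 y_mesh(3)]) (simp_all add: Y_nz)
  have y5: "cont (Y 7) 5 = (\<lambda>n. (Y 2 (n + 1) * Y 8 (n + 1)))"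
    by (rule cont_step[OF y3 y4 y_mesh(4)]) (simp_all add: Y_nz)
  have "Y 8 (n + 1) * Y 8 n = 1 + Y 1 n" for n
    using mesh[of 8 n] unfolding children by (simp add: par_def)
  then interpret e7_frieze "Y 4" "Y 7" "Y 8"
    by unfold_locales (simp_all add: x3 x4 x5 y3 y4 y5 Y_nz mult.commute)
  show ?thesis
  proof (rule trace_transfer[of "{4, 7}" Y, OF _ Y_def k])
    have seq: "\<exists>s. Y i = leaf_seq s" if "i \<in> {4, 7}" for i
    proof -
      have "Y 4 = leaf_seq 0" "Y 7 = leaf_seq 1"
        by (auto simp: leaf_seq_def)
      then show ?thesis using that by auto
    qed
    fix i j :: nat and n m
    assume "i \<in> {4, 7}" "j \<in> {4, 7}"
    then obtain s t where "Y i = leaf_seq s" "Y j = leaf_seq t" using seq by meson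
    then show "(Y i (n + 2 * 12) + Y i n) * Y j (m + 12) = (Y j (m + 2 * 12) + Y j m) * Y i (n + 12)"
      using trace[of s n t m] by simp
  qed
qed

lemma E8_tilde_trace:
  assumes fr: "frieze_sequence Q X" and l: "bij_betw l {1..9} (verts Q)"
    and graph: "underlying_simple_graph E8_tilde_edges l Q"
    and nz: "\<And>k n. k \<in> verts Q \<Longrightarrow> X k n \<noteq> 0"
    and k: "k \<in> l ` {6}" "k' \<in> l ` {6}"
  shows "(X k (n + 2 * 30) + X k n) * X k' (m + 30) = (X k' (m + 2 * 30) + X k' m) * X k (n + 30)"
proof -
  define par :: "nat \<Rightarrow> nat" where "par = (\<lambda>m. if m \<in> {2, 7, 9} then 1 else m - 1)"
  define d :: "nat \<Rightarrow> nat" where "d m = ([0, 0, 1, 2, 3, 4, 5, 1, 2, 1] ! m)" for m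
  have V: "{1..9::nat} = {1, 2, 3, 4, 5, 6, 7, 8, 9}" by auto
  obtain h where H: "\<And>m n. m \<in> {1..9} \<Longrightarrow>
    X (l m) (n + 1 + h m) * X (l m) (n + h m) =
      1 + (if m = 1 then 1 else X (l (par m)) (n + h (par m)))
        * (\<Prod>j\<in>{j \<in> {1..9} - {1}. par j = m}. X (l j) (n + 1 + h j))"
  proof (rule tree_frieze[OF fr l graph, of par 1 d])
    show "E8_tilde_edges = (\<lambda>m. {m, par m}) ` ({1..9} - {1})"
      unfolding V by (simp add: E8_tilde_edges_def par_def insert_commute)
  next
    fix m :: nat
    assume "m \<in> {1..9} - {1}"
    then have "m \<in> {2, 3, 4, 5, 6, 7, 8, 9}" unfolding V by auto
    then show "par m \<in> {1..9}" "d m = Suc (d (par m))"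
      by (auto simp: par_def d_def)
  qed (simp, rule that)
  define Y where "Y m n = X (l m) (n + h m)" for m n
  have Y_nz: "Y m n \<noteq> 0" if "m \<in> {1..9}" for m n
    using bij_betwE[OF l] nz that unfolding Y_def by blast
  have children:
    "{j \<in> {1..9} - {1}. par j = 1} = {2, 7, 9}"
    "{j \<in> {1..9} - {1}. par j = 2} = {3}"
    "{j \<in> {1..9} - {1}. par j = 3} = {4}"
    "{j \<in> {1..9} - {1}. par j = 4} = {5}"
    "{j \<in> {1..9} - {1}. par j = 5} = {6}"
    "{j \<in> {1..9} - {1}. par j = 6} = {}"
    "{j \<in> {1..9} - {1}. par j = 7} = {8}"
    "{j \<in> {1..9} - {1}. par j = 8} = {}"
    "{j \<in> {1..9} - {1}. par j = 9} = {}"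
    unfolding V by (auto simp: par_def)
  have mesh: "Y m (n + 1) * Y m n = 1 + (if m = 1 then 1 else Y (par m) n)
      * (\<Prod>j\<in>{j \<in> {1..9} - {1}. par j = m}. Y j (n + 1))" if "m \<in> {1..9}" for m n
    using H[OF that] by (simp add: Y_def)
  have x_mesh:
    "Y 6 (n + 1) * Y 6 n = 1 + 1 * Y 5 n"
    "Y 5 (n + 1) * Y 5 n = 1 + Y 6 (n + 1) * Y 4 n"
    "Y 4 (n + 1) * Y 4 n = 1 + Y 5 (n + 1) * Y 3 n"
    "Y 3 (n + 1) * Y 3 n = 1 + Y 4 (n + 1) * Y 2 n"
    "Y 2 (n + 1) * Y 2 n = 1 + Y 3 (n + 1) * Y 1 n"
    "Y 1 (n + 1) * Y 1 n = 1 + Y 2 (n + 1) * (Y 7 (n + 1) * Y 9 (n + 1))"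
    for n
    using mesh[of 6 n] mesh[of 5 n] mesh[of 4 n] mesh[of 3 n] mesh[of 2 n] mesh[of 1 n] unfolding children
    by (simp_all add: par_def mult_ac)
  note x1 = cont_0_1[of "Y 6"]
  have x2: "cont (Y 6) 2 = Y 5"
    by (rule cont_step[OF x1 x_mesh(1)]) (simp_all add: Y_nz)
  have x3: "cont (Y 6) 3 = Y 4"
    by (rule cont_step[OF x1(2) x2 x_mesh(2)]) (simp_all add: Y_nz)
  have x4: "cont (Y 6) 4 = Y 3"
    by (rule cont_step[OF x2 x3 x_mesh(3)]) (simp_all add: Y_nz)
  have x5: "cont (Y 6) 5 = Y 2"
    by (rule cont_step[OF x3 x4 x_mesh(4)]) (simp_all add: Y_nz)
  have x6: "cont (Y 6) 6 = Y 1"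
    by (rule cont_step[OF x4 x5 x_mesh(5)]) (simp_all add: Y_nz)
  have x7: "cont (Y 6) 7 = (\<lambda>n. (Y 7 (n + 1) * Y 9 (n + 1)))"
    by (rule cont_step[OF x5 x6 x_mesh(6)]) (simp_all add: Y_nz)
  have y_mesh:
    "Y 8 (n + 1) * Y 8 n = 1 + 1 * Y 7 n"
    "Y 7 (n + 1) * Y 7 n = 1 + Y 8 (n + 1) * Y 1 n"
    "Y 1 (n + 1) * Y 1 n = 1 + Y 7 (n + 1) * (Y 2 (n + 1) * Y 9 (n + 1))"
    for n
    using mesh[of 8 n] mesh[of 7 n] mesh[of 1 n] unfolding children
    by (simp_all add: par_def mult_ac)
  note y1 = cont_0_1[of "Y 8"]
  have y2: "cont (Y 8) 2 = Y 7"
    by (rule cont_step[OF y1 y_mesh(1)]) (simp_all add: Y_nz)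
  have y3: "cont (Y 8) 3 = Y 1"
    by (rule cont_step[OF y1(2) y2 y_mesh(2)]) (simp_all add: Y_nz)
  have y4: "cont (Y 8) 4 = (\<lambda>n. (Y 2 (n + 1) * Y 9 (n + 1)))"
    by (rule cont_step[OF y2 y3 y_mesh(3)]) (simp_all add: Y_nz)
  have "Y 9 (n + 1) * Y 9 n = 1 + Y 1 n" for n
    using mesh[of 9 n] unfolding children by (simp add: par_def)
  then interpret e8_frieze "Y 6" "Y 8" "Y 9"
    by unfold_locales (simp_all add: x5 x6 x7 y2 y3 y4 Y_nz mult.commute)
  show ?thesis
  proof (rule trace_transfer[of "{6}" Y, OF _ Y_def k])
    fix i j :: nat and n m
    assume "i \<in> {6}" "j \<in> {6}"
    then show "(Y i (n + 2 * 30) + Y i n) * Y j (m + 30) = (Y j (m + 2 * 30) + Y j m) * Y i (n + 30)"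
      using trace[of n m] by simp
  qed
qed

lemma A_tilde_trace:
  assumes fr: "frieze_sequence Q X" and l: "bij_betw l {1..p + q} (verts Q)"
    and cyc: "oriented_cycle p q l Q" and pq: "1 \<le> p" "1 \<le> q"
    and nz: "\<And>k n. k \<in> verts Q \<Longrightarrow> X k n \<noteq> 0"
    and k: "k \<in> l ` {1..p + q}" "k' \<in> l ` {1..p + q}" and b: "b = int (lcm p q)"
  shows "(X k (n + 2 * b) + X k n) * X k' (m + b) = (X k' (m + 2 * b) + X k' m) * X k (n + b)"
proof -
  define Y where "Y h t n = X (l (nat (t mod int (p + q)) + 1)) (n + h t)" for h :: "int \<Rightarrow> int" and t n
  obtain h where "a_frieze (int p) (int q) (\<lambda>t n. X (l (nat (t mod int (p + q)) + 1)) (n + h t))"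
    by (rule cycle_frieze[OF fr l cyc pq]) (rule nz)
  then interpret a_frieze "int p" "int q" "Y h"
    unfolding Y_def[abs_def] .
  \<comment> \<open>Labels start at 1, positions on the unrolled line at 0.\<close>
  define Z where "Z i n = X (l i) (n + h (int i - 1))" for i n
  have Z: "Z i = Y h (int i - 1)" if "i \<in> {1..p + q}" for i
  proof -
    have "(int i - 1) mod int (p + q) = int i - 1" using that by simp
    then have "nat ((int i - 1) mod int (p + q)) + 1 = i" using that by (simp add: nat_diff_distrib)
    then show ?thesis unfolding Z_def Y_def by (simp only:)
  qed
  obtain c d where "lcm p q = p * c" "lcm p q = q * d"
    by (metis dvd_lcm1 dvd_lcm2 dvdE)
  then have "b = int p * int c" "b = int q * int d"
    by (simp_all add: b flip: of_nat_mult)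
  note tr = trace[OF this]
  show ?thesis
    by (rule trace_transfer[of "{1..p + q}" Z, OF _ Z_def k]) (simp only: Z tr)
qed

lemma D_tilde_trace:
  assumes fr: "frieze_sequence Q X" and l: "bij_betw l {1..N + 1} (verts Q)"
    and graph: "underlying_simple_graph (D_tilde_edges N) l Q" and N: "4 \<le> N"
    and nz: "\<And>k n. k \<in> verts Q \<Longrightarrow> X k n \<noteq> 0"
    and k: "k \<in> l ` {1, 2, N, N + 1}" "k' \<in> l ` {1, 2, N, N + 1}"
    and b: "even b" "b = int (N - 2) * c"
  shows "(X k (n + 2 * b) + X k n) * X k' (m + b) = (X k' (m + 2 * b) + X k' m) * X k (n + b)"
proof -
  define par where "par m = (if m \<le> 2 then 3 else if m \<le> N - 2 then m + 1 else N - 1)" for m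
  define d where "d m = (if m \<le> 2 then N - 3 else if m \<le> N - 1 then N - 1 - m else 1)" for m
  obtain h where H: "\<And>m n. m \<in> {1..N + 1} \<Longrightarrow>
    X (l m) (n + 1 + h m) * X (l m) (n + h m) =
      1 + (if m = N - 1 then 1 else X (l (par m)) (n + h (par m)))
        * (\<Prod>j\<in>{j \<in> {1..N + 1} - {N - 1}. par j = m}. X (l j) (n + 1 + h j))"
  proof (rule tree_frieze[OF fr l graph, of par "N - 1" d])
    have dom: "{1..N + 1} - {N - 1} = {1, 2} \<union> {i. 3 \<le> i \<and> i \<le> N - 2} \<union> {N, N + 1}"
      using N by auto
    have "(\<lambda>m. {m, par m}) ` {1, 2} = {{1, 3}, {2, 3}}"
      by (simp add: par_def)
    moreover have "(\<lambda>m. {m, par m}) ` {i. 3 \<le> i \<and> i \<le> N - 2} = {{i, i + 1} |i. 3 \<le> i \<and> i \<le> N - 2}"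
    proof -
      have "(\<lambda>m. {m, par m}) ` {i. 3 \<le> i \<and> i \<le> N - 2} = (\<lambda>i. {i, i + 1}) ` {i. 3 \<le> i \<and> i \<le> N - 2}"
        by (rule image_cong) (simp_all add: par_def)
      then show ?thesis by blast
    qed
    moreover have "(\<lambda>m. {m, par m}) ` {N, N + 1} = {{N - 1, N}, {N - 1, N + 1}}"
    proof -
      have "par N = N - 1" "par (N + 1) = N - 1" using N by (auto simp: par_def)
      then show ?thesis by (simp only: image_insert image_empty) (simp only: insert_commute)
    qed
    ultimately show "D_tilde_edges N = (\<lambda>m. {m, par m}) ` ({1..N + 1} - {N - 1})"
      unfolding dom image_Un D_tilde_edges_def by (simp only:)
  qed (use N in \<open>auto simp: par_def d_def\<close>)
  define Y where "Y m n = X (l m) (n + h m)" for m n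
  have Y_nz: "Y m n \<noteq> 0" if "m \<in> {1..N + 1}" for m n
    using bij_betwE[OF l] nz that unfolding Y_def by blast
  have mesh: "Y m (n + 1) * Y m n = 1 + (if m = N - 1 then 1 else Y (par m) n)
      * (\<Prod>j\<in>{j \<in> {1..N + 1} - {N - 1}. par j = m}. Y j (n + 1))" if "m \<in> {1..N + 1}" for m n
    unfolding Y_def using H[OF that] .
  define r where "r = N - 2"
  \<comment> \<open>With the root at \<open>N - 1\<close>, the leaves \<open>N\<close> and
    \<open>N + 1\<close> are children and enter its mesh relation at time \<open>n + 1\<close>;
    taking them one unit later makes them the end \<open>U r\<close> of the chain.\<close>
  define U where "U i n = (if i = 0 then Y 1 n * Y 2 n else if i < r then Y (i + 2) n
      else Y N (n + 1) * Y (N + 1) (n + 1))" for i n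
  have leaf: "Y m (n + 1) * Y m n = 1 + Y (par m) n" if "m \<in> {1, 2, N, N + 1}" for m n
  proof -
    have m: "{j \<in> {1..N + 1} - {N - 1}. par j = m} = {}" "m \<noteq> N - 1" "m \<in> {1..N + 1}"
      using that N by (auto simp: par_def)
    show ?thesis using mesh[OF m(3), of n] m(2) unfolding m(1) by simp
  qed
  have par: "par 1 = 3" "par 2 = 3" "par N = N - 1" "par (N + 1) = N - 1"
    using N by (auto simp: par_def)
  interpret d_frieze r "Y 1" "Y 2" "\<lambda>n. Y N (n + 1)" "\<lambda>n. Y (N + 1) (n + 1)" U
  proof
    show "2 \<le> r" using N by (simp add: r_def)
    fix i n
    assume i: "0 < i" "i < r"
    define m where "m = i + 2"
    have m: "3 \<le> m" "m \<le> N - 1" using i by (auto simp: m_def r_def)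
    \<comment> \<open>For \<open>N = 4\<close> the vertex 3 is also \<open>N - 1\<close> and has
      both pairs of leaves as children; hence two independent cases.\<close>
    define L R where "L = (if m = 3 then {1, 2} else {m - 1})" and "R = (if m = N - 1 then {N, N + 1} else {})"
    have children: "{j \<in> {1..N + 1} - {N - 1}. par j = m} = L \<union> R"
      and dis: "L \<inter> R = {}" "finite L" "finite R"
      using m N by (auto simp: par_def L_def R_def split: if_splits)
    have "Y m (n + 1) * Y m n = 1 + (if m = N - 1 then 1 else Y (par m) n)
        * ((\<Prod>j\<in>L. Y j (n + 1)) * (\<Prod>j\<in>R. Y j (n + 1)))"
      using mesh[of m n] dis m unfolding children by (simp add: prod.union_disjoint)
    moreover have "(\<Prod>j\<in>L. Y j (n + 1)) = U (i - 1) (n + 1)"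
      using i by (auto simp: L_def U_def m_def)
    moreover have "(if m = N - 1 then 1 else Y (par m) n) * (\<Prod>j\<in>R. Y j (n + 1)) = U (i + 1) n"
      using m i by (auto simp: R_def U_def m_def r_def par_def)
    moreover have "U i n = Y m n" "U i (n + 1) = Y m (n + 1)"
      using i by (auto simp: U_def m_def)
    ultimately show "U i (n + 1) * U i n = 1 + U (i - 1) (n + 1) * U (i + 1) n"
      by (simp add: mult_ac)
  next
    fix i n
    assume "i \<le> r"
    then show "U i n \<noteq> 0" using N Y_nz by (auto simp: U_def r_def)
  next
    fix n
    have "U 1 n = Y 3 n" "U (r - 1) (n + 1) = Y (N - 1) (n + 1)"
      using N by (auto simp: U_def r_def numeral_3_eq_3 intro!: arg_cong2[of _ _ _ _ Y])
    then show "Y 1 (n + 1) * Y 1 n = 1 + U 1 n" "Y 2 (n + 1) * Y 2 n = 1 + U 1 n"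
      "Y N (n + 1 + 1) * Y N (n + 1) = 1 + U (r - 1) (n + 1)"
      "Y (N + 1) (n + 1 + 1) * Y (N + 1) (n + 1) = 1 + U (r - 1) (n + 1)"
      using leaf[of _ n] leaf[of _ "n + 1"] par by simp_all
  qed (use N Y_nz in \<open>simp_all add: U_def r_def\<close>)
  note tr = trace[OF b(1) b(2)[folded r_def]]
  show ?thesis
  proof (rule trace_transfer[of "{1, 2, N, N + 1}" Y, OF _ Y_def k])
    have seq: "\<exists>c s t. \<forall>n. Y i n = leaf_seq c s (n + t)" if "i \<in> {1, 2, N, N + 1}" for i
    proof -
      have "Y 1 n = leaf_seq True 0 (n + 0)" "Y 2 n = leaf_seq True 1 (n + 0)"
        "Y N n = leaf_seq False 0 (n + (- 1))" "Y (N + 1) n = leaf_seq False 1 (n + (- 1))" for n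
        unfolding leaf_seq_def by simp_all
      then show ?thesis using that by blast
    qed
    fix i j n m
    assume "i \<in> {1, 2, N, N + 1}" "j \<in> {1, 2, N, N + 1}"
    then obtain c s t c' s' t' where "\<And>n. Y i n = leaf_seq c s (n + t)" "\<And>n. Y j n = leaf_seq c' s' (n + t')"
      using seq by meson
    then show "(Y i (n + 2 * b) + Y i n) * Y j (m + b) = (Y j (m + 2 * b) + Y j m) * Y i (n + b)"
      using tr[of c s "n + t" c' s' "m + t'"] by (simp add: add_ac)
  qed
qed

theorem theorem1p1:
  fixes Q :: "('v::{finite,linorder}, 'e) pre_digraph"
    and T :: affine_type
    and l :: "nat \<Rightarrow> 'v"
    and X :: "'v \<Rightarrow> int \<Rightarrow> 'v ratfun"
    and \<phi> :: "'v ratfun \<Rightarrow> 'v ratfun"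
    and b :: int
  assumes "verts Q = UNIV"
    and "acyclic_quiver Q"
    and "quiver_of_type T l Q"
    and "frieze_sequence Q X"
    and "is_shift Q X \<phi>"
    and "b = int (period T)"
  shows "\<exists>K :: 'v ratfun. \<phi> K = K \<and>
    (\<forall>k \<in> l ` extending_labels T. \<forall>n :: int.
       X k (n + 2 * b) - K * X k (n + b) + X k n = 0)"
proof (rule invariant_trace[OF assms(5)])
  have nz: "X k n \<noteq> 0" if "k \<in> verts Q" for k n
    using frieze_nonzero[OF assms(4,5) that] .
  show "X k n \<noteq> 0" for k n using nz assms(1) by simp
  show "l ` extending_labels T \<subseteq> verts Q" using assms(1) by simp
  have T: "admissible T" "bij_betw l {1..num_vertices T} (verts Q)" "has_diagram T l Q"
    using assms(3) by (simp_all add: quiver_of_type_def)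
  show "l ` extending_labels T \<noteq> {}" using T(1) by (cases T) auto
  fix k k' n m
  assume k: "k \<in> l ` extending_labels T" "k' \<in> l ` extending_labels T"
  show "(X k (n + 2 * b) + X k n) * X k' (m + b) = (X k' (m + 2 * b) + X k' m) * X k (n + b)"
  proof (cases T)
    case (A_tilde p q)
    show ?thesis
      by (rule A_tilde_trace[OF assms(4), of l p q]) (use T k nz assms(6) A_tilde in simp_all)
  next
    case (D_tilde N)
    \<comment> \<open>For odd \<open>N\<close>, \<open>N - 2\<close> is odd and is doubled so that
      the alternation of the leaves closes up.\<close>
    define c :: int where "c = (if even N then 1 else 2)"
    have "even b" "b = int (N - 2) * c"
      using T(1) assms(6) D_tilde by (auto simp: c_def)
    then show ?thesis
      by (intro D_tilde_trace[OF assms(4), of l N]) (use T k nz D_tilde in simp_all)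
  next
    case E6_tilde
    then show ?thesis
      using E6_tilde_trace[OF assms(4) _ _ nz] T k assms(6) by simp
  next
    case E7_tilde
    then show ?thesis
      using E7_tilde_trace[OF assms(4) _ _ nz] T k assms(6) by simp
  next
    case E8_tilde
    then show ?thesis
      using E8_tilde_trace[OF assms(4) _ _ nz] T k assms(6) by simp
  qed
qed

end
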